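(* $\tau^S_5\geq\frac{1}{2}$.
   Context: For a pure simplicial complex $\Delta$, $T(\Delta)$ is the minimum size of a set of vertices meeting every facet and $\tau(\Delta)=T(\Delta)/(\text{number of vertices of }\Delta)$. For $d\ge2$, $\tau^S_d=\limsup_{n\to\infty}\max\{\tau(\Delta): \Delta \text{ is a simplicial } (d-1)\text{-sphere with } n \text{ vertices}\}$, where a simplicial $(d-1)$-sphere is a simplicial complex whose geometric realization is homeomorphic to the $(d-1)$-sphere. *)

theory Defs
  imports "HOL-Analysis.Analysis"
begin

text \<open>Finite abstract simplicial complexes, given by their set of faces; the empty face is included.\<close>

definition simplicial_complex :: "'a set set \<Rightarrow> bool" where
  "simplicial_complex K \<longleftrightarrow>
     finite K \<and> {} \<in> K \<and> (\<forall>\<sigma>\<in>K. finite \<sigma>) \<and> (\<forall>\<sigma>\<in>K. \<forall>\<rho>. \<rho> \<subseteq> \<sigma> \<longrightarrow> \<rho> \<in> K)"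

text \<open>By downward closure this is the set of all \<open>v\<close> such that \<open>{v}\<close> is a face.\<close>

definition vertices :: "'a set set \<Rightarrow> 'a set" where
  "vertices K = \<Union>K"

definition facets :: "'a set set \<Rightarrow> 'a set set" where
  "facets K = {\<sigma> \<in> K. \<forall>\<rho>\<in>K. \<sigma> \<subseteq> \<rho> \<longrightarrow> \<rho> = \<sigma>}"

text \<open>The points of the realization are the barycentric coordinate functions whose support is a
  face. For a finite complex the weak topology is the subspace topology inherited from the
  product topology on real-valued functions.\<close>

definition geometric_realization :: "'a set set \<Rightarrow> ('a \<Rightarrow> real) topology" where
  "geometric_realization K =
     subtopology (powertop_real UNIV)
       {x. (\<forall>v. 0 \<le> x v) \<and> {v. x v \<noteq> 0} \<in> K \<and> (\<Sum>v | x v \<noteq> 0. x v) = 1}"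

text \<open>\<open>nsphere m\<close> is the \<open>m\<close>-dimensional unit sphere in Euclidean \<open>(m + 1)\<close>-space.\<close>

definition simplicial_sphere :: "nat \<Rightarrow> 'a set set \<Rightarrow> bool" where
  "simplicial_sphere m K \<longleftrightarrow>
     simplicial_complex K \<and> geometric_realization K homeomorphic_space nsphere m"

text \<open>Purity is not assumed separately: every simplicial sphere is pure.\<close>

definition transversal_number :: "'a set set \<Rightarrow> nat" where
  "transversal_number K =
     Min (card ` {S. S \<subseteq> vertices K \<and> (\<forall>\<sigma>\<in>facets K. S \<inter> \<sigma> \<noteq> {})})"

definition transversal_ratio :: "'a set set \<Rightarrow> real" where
  "transversal_ratio K = real (transversal_number K) / real (card (vertices K))"

text \<open>Every finite complex is isomorphic to one with vertices in \<open>nat\<close>, so it suffices to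
  consider those. The maximum is over a finite set of ratios, which for \<open>d \<ge> 2\<close> is nonempty
  when \<open>n > d\<close>; the finitely many smaller \<open>n\<close> do not affect the limit superior.\<close>

definition tau_S :: "nat \<Rightarrow> ereal" where
  "tau_S d = limsup (\<lambda>n. ereal (Max {transversal_ratio K | K :: nat set set.
     simplicial_sphere (d - 1) K \<and> card (vertices K) = n}))"

end

theory Submission
  imports Defs
begin

text \<open>Two families of facets that differ by a bistellar flip have a common stellar subdivision, so flips
  preserve the homeomorphism type of the realization. Starting from the boundary of the 5-dimensional
  cross-polytope we grow, by stellar subdivisions and flips, 4-spheres in which most vertices lie on one
  long path. A block of \<open>h\<close> new vertices is appended to the path, and the join of the part of the block
  from its \<open>s\<close>-th vertex \<open>r\<close> on with a prescribed interval \<open>Q\<^sub>s\<close> of the older path is retriangulated by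
  the fan with apex \<open>r\<close>. This creates all facets \<open>{r, i, i + 1, j, j + 1}\<close> with \<open>i > r\<close> in the block and
  \<open>j, j + 1 \<in> Q\<^sub>s\<close>.

  Let \<open>I\<close> contain no facet (the complement of a transversal). If \<open>I\<close> contains two consecutive vertices
  of every interval \<open>Q\<^sub>s\<close>, then behind its first vertex in a block it has no two consecutive block
  vertices, so it has density about 1/2 there. Otherwise it has density at most 1/2 on some \<open>Q\<^sub>s\<close>.
  Letting the \<open>Q\<^sub>s\<close> be copies of the same construction and iterating, the excess of the density of \<open>I\<close>
  over 1/2 shrinks by a constant factor until it is at most of order \<open>1/h\<close>.\<close>

section \<open>Stellar subdivisions\<close>

text \<open>A fan constrains \<open>I\<close> only if its apex and an edge of its interval lie in
  \<open>I\<close>. Since \<open>I\<close> is arbitrary, every vertex of a block has to be available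
  as an apex. The fan with apex \<open>r\<close> is carved out of the facets
  \<open>{1, i, i + 1, j, j + 1}\<close> with \<open>i \<ge> r\<close>, so fans with different
  apexes compete for the same facets unless their intervals are disjoint. A block of
  \<open>h\<close> vertices therefore takes \<open>h\<close> disjoint intervals, and
  \<open>I\<close> can disarm it by becoming sparse on just one of them. This obstacle forces the
  recursion: each of the \<open>h\<close> copies is made \<open>h\<close> times as long as all
  blocks together, so that what \<open>I\<close> loses on one sparse copy outweighs even blocks that
  lie entirely in \<open>I\<close>. What remains is a constant excess per block of
  \<open>h + 2\<close> vertices, and this is the source of the order \<open>1/h\<close>.\<close>

definition faces :: "'a set set \<Rightarrow> 'a set set" where
  "faces F = {\<tau>. \<exists>\<sigma>\<in>F. \<tau> \<subseteq> \<sigma>}"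

definition bary :: "'a set set \<Rightarrow> ('a \<Rightarrow> real) set" where
  "bary F = {x. (\<forall>v. 0 \<le> x v) \<and> (\<exists>\<sigma>\<in>F. (\<forall>v. v \<notin> \<sigma> \<longrightarrow> x v = 0) \<and> sum x \<sigma> = 1)}"

text \<open>Any facet containing the support can replace the support in the normalization, since a
  finite facet only adds zero coordinates. This lets piecewise linear maps be checked facet by
  facet.\<close>

lemma geometric_realization_faces:
  assumes "\<And>\<sigma>. \<sigma> \<in> F \<Longrightarrow> finite \<sigma>"
  shows "geometric_realization (faces F) = subtopology (powertop_real UNIV) (bary F)"
proof -
  have supp: "(\<Sum>v | x v \<noteq> 0. x v) = sum x \<sigma>" if "\<sigma> \<in> F" "\<forall>v. v \<notin> \<sigma> \<longrightarrow> x v = 0" for x :: "'a \<Rightarrow> real" and \<sigma>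
    using that assms by (intro sum.mono_neutral_left) auto
  have "{x. (\<forall>v. 0 \<le> x v) \<and> {v. x v \<noteq> 0} \<in> faces F \<and> (\<Sum>v | x v \<noteq> 0. x v) = 1} = bary F"
    unfolding bary_def faces_def
  proof (intro Collect_cong conj_cong refl)
    fix x :: "'a \<Rightarrow> real"
    show "{v. x v \<noteq> 0} \<in> {\<tau>. \<exists>\<sigma>\<in>F. \<tau> \<subseteq> \<sigma>} \<and> (\<Sum>v | x v \<noteq> 0. x v) = 1 \<longleftrightarrow>
      (\<exists>\<sigma>\<in>F. (\<forall>v. v \<notin> \<sigma> \<longrightarrow> x v = 0) \<and> sum x \<sigma> = 1)"
    proof
      assume "{v. x v \<noteq> 0} \<in> {\<tau>. \<exists>\<sigma>\<in>F. \<tau> \<subseteq> \<sigma>} \<and> (\<Sum>v | x v \<noteq> 0. x v) = 1"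
      then obtain \<sigma> where s: "\<sigma> \<in> F" "{v. x v \<noteq> 0} \<subseteq> \<sigma>" "(\<Sum>v | x v \<noteq> 0. x v) = 1" by blast
      then have *: "\<forall>v. v \<notin> \<sigma> \<longrightarrow> x v = 0" by blast
      then show "\<exists>\<sigma>\<in>F. (\<forall>v. v \<notin> \<sigma> \<longrightarrow> x v = 0) \<and> sum x \<sigma> = 1"
        using supp[OF s(1) *] s by auto
    next
      assume "\<exists>\<sigma>\<in>F. (\<forall>v. v \<notin> \<sigma> \<longrightarrow> x v = 0) \<and> sum x \<sigma> = 1"
      then obtain \<sigma> where s: "\<sigma> \<in> F" "\<forall>v. v \<notin> \<sigma> \<longrightarrow> x v = 0" "sum x \<sigma> = 1" by blast
      then show "{v. x v \<noteq> 0} \<in> {\<tau>. \<exists>\<sigma>\<in>F. \<tau> \<subseteq> \<sigma>} \<and> (\<Sum>v | x v \<noteq> 0. x v) = 1"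
        using supp[OF s(1,2)] by auto
    qed
  qed
  then show ?thesis unfolding geometric_realization_def by simp
qed

lemma continuous_map_Min:
  fixes f :: "'i \<Rightarrow> 'a \<Rightarrow> real"
  assumes "finite I" "I \<noteq> {}" "\<And>i. i \<in> I \<Longrightarrow> continuous_map X euclideanreal (f i)"
  shows "continuous_map X euclideanreal (\<lambda>x. Min ((\<lambda>i. f i x) ` I))"
  using assms
proof (induction I rule: finite_ne_induct)
  case (insert i I)
  then show ?case
    by (simp add: continuous_map_real_min)
qed simp

definition stellar :: "'a set \<Rightarrow> 'a \<Rightarrow> 'a set set \<Rightarrow> 'a set set" where
  "stellar A v F = {\<sigma> \<in> F. \<not> A \<subseteq> \<sigma>} \<union> {insert v (\<sigma> - {f}) | \<sigma> f. \<sigma> \<in> F \<and> A \<subseteq> \<sigma> \<and> f \<in> A}"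

lemma geometric_realization_stellar:
  fixes F :: "'a set set"
  assumes fin: "\<And>\<sigma>. \<sigma> \<in> F \<Longrightarrow> finite \<sigma>" and A: "finite A" "A \<noteq> {}" and v: "v \<notin> \<Union>F" "v \<notin> A"
  shows "geometric_realization (faces F) homeomorphic_space geometric_realization (faces (stellar A v F))"
proof -
  have fin': "\<And>\<sigma>. \<sigma> \<in> stellar A v F \<Longrightarrow> finite \<sigma>"
    using fin by (auto simp: stellar_def)
  text \<open>The vertex \<open>v\<close> is placed at the barycenter of \<open>A\<close>: \<open>\<phi>\<close> is the resulting linear map on each facet,
    and its inverse \<open>\<psi>\<close> gives \<open>v\<close> the largest multiple of the barycenter that fits below \<open>x\<close>.\<close>
  define m where "m x = Min (x ` A)" for x :: "'a \<Rightarrow> real"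
  define \<psi> where "\<psi> x = (\<lambda>i. if i = v then card A * m x else if i \<in> A then x i - m x else x i)" for x
  define \<phi> where "\<phi> x = (\<lambda>i. if i = v then 0 else if i \<in> A then x i + x v / card A else x i)" for x :: "'a \<Rightarrow> real"
  have cA: "real (card A) > 0" using A by (simp add: card_gt_0_iff)
  have m_le: "m x \<le> x i" if "i \<in> A" for x i
    using A that by (auto simp: m_def)
  have m_ex: "\<exists>i\<in>A. m x = x i" for x
    unfolding m_def using Min_in[of "x ` A"] A by blast
  have m_zero: "m x = 0" if "\<And>i. 0 \<le> x i" "i \<in> A" "x i = 0" for x i
    using m_le[of i x] m_ex[of x] that by (metis antisym)
  have contm: "continuous_map (powertop_real UNIV) euclideanreal m"
    unfolding m_def using A by (intro continuous_map_Min continuous_map_product_projection) auto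
  have c\<psi>: "continuous_map (powertop_real UNIV) (powertop_real UNIV) \<psi>"
    unfolding continuous_map_componentwise_UNIV
  proof
    fix k show "continuous_map (powertop_real UNIV) euclideanreal (\<lambda>x. \<psi> x k)"
      unfolding \<psi>_def using contm
      by (auto intro!: continuous_intros)
  qed
  have c\<phi>: "continuous_map (powertop_real UNIV) (powertop_real UNIV) \<phi>"
    unfolding continuous_map_componentwise_UNIV
  proof
    fix k show "continuous_map (powertop_real UNIV) euclideanreal (\<lambda>x. \<phi> x k)"
      unfolding \<phi>_def using cA
      by (auto intro!: continuous_intros)
  qed
  have \<psi>_in: "\<psi> x \<in> bary (stellar A v F)" and \<phi>\<psi>: "\<phi> (\<psi> x) = x" if "x \<in> bary F" for x
  proof -
    from that obtain \<sigma> where s: "\<sigma> \<in> F" "\<forall>i. i \<notin> \<sigma> \<longrightarrow> x i = 0" "sum x \<sigma> = 1" and nn: "\<And>i. 0 \<le> x i"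
      by (auto simp: bary_def)
    have v\<sigma>: "v \<notin> \<sigma>" using s v by auto
    then have xv: "x v = 0" using s by auto
    show "\<phi> (\<psi> x) = x"
      using cA v(2) xv by (auto simp: fun_eq_iff \<phi>_def \<psi>_def)
    have m0: "0 \<le> m x" using m_ex[of x] nn by metis
    have nn': "0 \<le> \<psi> x i" for i
      using m0 nn m_le by (auto simp: \<psi>_def)
    show "\<psi> x \<in> bary (stellar A v F)"
    proof (cases "A \<subseteq> \<sigma>")
      case False
      then obtain i where "i \<in> A" "i \<notin> \<sigma>" by blast
      then have "m x = 0" using s nn m_zero by blast
      then have "\<psi> x = x" using xv by (auto simp: \<psi>_def fun_eq_iff)
      moreover have "\<sigma> \<in> stellar A v F" using s False by (auto simp: stellar_def)
      ultimately show ?thesis using s nn by (auto simp: bary_def)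
    next
      case True
      \<comment> \<open>The coordinate of a minimizer \<open>f\<close> drops to 0, so
        \<open>\<psi> x\<close> lies on the facet in which \<open>v\<close> replaces
        \<open>f\<close>.\<close>
      obtain f where f: "f \<in> A" "m x = x f" using m_ex by blast
      let ?\<tau> = "insert v (\<sigma> - {f})"
      have t: "?\<tau> \<in> stellar A v F" using s True f by (auto simp: stellar_def)
      have z: "\<forall>i. i \<notin> ?\<tau> \<longrightarrow> \<psi> x i = 0"
        using s f True by (auto simp: \<psi>_def)
      have fs: "finite \<sigma>" using fin s by auto
      have "sum (\<psi> x) ?\<tau> = \<psi> x v + sum (\<psi> x) (\<sigma> - {f})"
        using fs v\<sigma> by simp
      also have "sum (\<psi> x) (\<sigma> - {f}) = sum (\<psi> x) \<sigma>"
        using fs f v by (intro sum.mono_neutral_left) (auto simp: \<psi>_def)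
      also have "sum (\<psi> x) \<sigma> = sum (\<psi> x) (\<sigma> - A) + sum (\<psi> x) A"
        using fs True by (rule sum.subset_diff[rotated])
      also have "sum (\<psi> x) (\<sigma> - A) = sum x (\<sigma> - A)"
        using v\<sigma> by (intro sum.cong) (auto simp: \<psi>_def)
      also have "sum (\<psi> x) A = (\<Sum>i\<in>A. x i - m x)"
        using v by (intro sum.cong) (auto simp: \<psi>_def)
      also have "\<dots> = sum x A - card A * m x"
        by (simp add: sum_subtractf)
      also have "\<psi> x v + (sum x (\<sigma> - A) + (sum x A - card A * m x)) = sum x \<sigma>"
        using sum.subset_diff[OF True fs, of x] by (simp add: \<psi>_def)
      finally have "sum (\<psi> x) ?\<tau> = 1" using s by simp
      then show ?thesis using t z nn' unfolding bary_def by blast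
    qed
  qed
  have \<phi>_in: "\<phi> x \<in> bary F" and \<psi>\<phi>: "\<psi> (\<phi> x) = x" if "x \<in> bary (stellar A v F)" for x
  proof -
    from that obtain \<tau> where t: "\<tau> \<in> stellar A v F" "\<forall>i. i \<notin> \<tau> \<longrightarrow> x i = 0" "sum x \<tau> = 1" and nn: "\<And>i. 0 \<le> x i"
      by (auto simp: bary_def)
    have nn': "0 \<le> \<phi> x i" for i
      using nn by (auto simp: \<phi>_def)
    \<comment> \<open>A facet of the subdivision misses some vertex \<open>g\<close> of
      \<open>A\<close>. There \<open>\<phi> x\<close> equals \<open>x v / card A\<close>, which is
      therefore its minimum on \<open>A\<close>, and \<open>\<psi>\<close> recovers
      \<open>x v\<close> from it.\<close>
    obtain g where g: "g \<in> A" "g \<notin> \<tau>"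
      using t(1) v by (auto simp: stellar_def)
    have m\<phi>: "m (\<phi> x) = x v / card A"
    proof (rule antisym)
      have "m (\<phi> x) \<le> \<phi> x g" using m_le g by blast
      also have "\<dots> = x v / card A" using g t v by (auto simp: \<phi>_def)
      finally show "m (\<phi> x) \<le> x v / card A" .
      obtain i where i: "i \<in> A" "m (\<phi> x) = \<phi> x i" using m_ex by blast
      then have "i \<noteq> v" using v by auto
      then show "x v / card A \<le> m (\<phi> x)" using i nn[of i] by (auto simp: \<phi>_def)
    qed
    show "\<psi> (\<phi> x) = x"
      using cA m\<phi> by (auto simp: fun_eq_iff \<psi>_def) (auto simp: \<phi>_def)
    show "\<phi> x \<in> bary F"
      using t(1) unfolding stellar_def
    proof (elim UnE CollectE exE conjE)
      assume "\<tau> \<in> F" "\<not> A \<subseteq> \<tau>"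
      then have "x v = 0" using v t by auto
      then have "\<phi> x = x" by (auto simp: \<phi>_def fun_eq_iff)
      then show ?thesis using t nn \<open>\<tau> \<in> F\<close> by (auto simp: bary_def)
    next
      fix \<sigma> f assume s: "\<tau> = insert v (\<sigma> - {f})" "\<sigma> \<in> F" "A \<subseteq> \<sigma>" "f \<in> A"
      have v\<sigma>: "v \<notin> \<sigma>" using s v by auto
      have fs: "finite \<sigma>" using fin s by auto
      have xf: "x f = 0" using s t v by auto
      have z: "\<forall>i. i \<notin> \<sigma> \<longrightarrow> \<phi> x i = 0"
        using s t by (auto simp: \<phi>_def)
      have "sum (\<phi> x) \<sigma> = sum (\<phi> x) (\<sigma> - A) + sum (\<phi> x) A"
        using fs s by (intro sum.subset_diff) auto
      also have "sum (\<phi> x) (\<sigma> - A) = sum x (\<sigma> - A)"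
        using v\<sigma> by (intro sum.cong) (auto simp: \<phi>_def)
      also have "sum (\<phi> x) A = (\<Sum>i\<in>A. x i + x v / card A)"
        using v by (intro sum.cong) (auto simp: \<phi>_def)
      also have "\<dots> = sum x A + x v"
        using cA by (simp add: sum.distrib)
      also have "sum x (\<sigma> - A) + (sum x A + x v) = x v + sum x \<sigma>"
        using sum.subset_diff[OF s(3) fs, of x] by simp
      also have "sum x \<sigma> = sum x (\<sigma> - {f})"
        using fs xf by (intro sum.mono_neutral_right) auto
      also have "x v + sum x (\<sigma> - {f}) = sum x \<tau>"
        using s fs v\<sigma> by simp
      finally show ?thesis using z nn' s t unfolding bary_def by auto
    qed
  qed
  have "homeomorphic_maps (subtopology (powertop_real UNIV) (bary F))
     (subtopology (powertop_real UNIV) (bary (stellar A v F))) \<psi> \<phi>"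
    unfolding homeomorphic_maps_def
    using \<psi>_in \<phi>_in \<phi>\<psi> \<psi>\<phi>
    by (auto simp: continuous_map_in_subtopology intro!: continuous_map_from_subtopology c\<psi> c\<phi>)
  then show ?thesis
    using geometric_realization_faces[OF fin] geometric_realization_faces[OF fin'] homeomorphic_space_def
    by metis
qed

section \<open>Cross-polytopes\<close>

definition cross :: "(nat \<Rightarrow> 'a) \<Rightarrow> (nat \<Rightarrow> 'a) \<Rightarrow> nat \<Rightarrow> 'a set set" where
  "cross a b n = {a ` I \<union> b ` ({..n} - I) | I. I \<subseteq> {..n}}"

text \<open>A point of the realization is a point of the l1 unit sphere, split into positive parts
  at the \<open>a i\<close> and negative parts at the \<open>b i\<close>. \<open>f\<close> undoes
  the splitting and projects radially to the Euclidean sphere; \<open>g\<close> scales back to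
  l1-norm 1 and splits again.\<close>

lemma geometric_realization_cross:
  fixes a b :: "nat \<Rightarrow> 'a"
  assumes inj: "inj_on a {..n}" "inj_on b {..n}" and disj: "a ` {..n} \<inter> b ` {..n} = {}"
  shows "geometric_realization (faces (cross a b n)) homeomorphic_space nsphere n"
proof -
  have fin: "\<And>\<sigma>. \<sigma> \<in> cross a b n \<Longrightarrow> finite \<sigma>"
    by (auto simp: cross_def finite_subset)
  have aeq: "a i = a j \<longleftrightarrow> i = j" "b i = b j \<longleftrightarrow> i = j" "a i \<noteq> b j" "b i \<noteq> a j" if "i \<le> n" "j \<le> n" for i j
    using inj disj that by (auto dest: inj_onD)
  define D where "D x = (\<lambda>i. x (a i) - x (b i))" for x :: "'a \<Rightarrow> real"
  define N where "N y = sqrt (\<Sum>i\<le>n. (y i)\<^sup>2)" for y :: "nat \<Rightarrow> real"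
  define M where "M y = (\<Sum>i\<le>n. \<bar>y i\<bar>)" for y :: "nat \<Rightarrow> real"
  define f where "f x = (\<lambda>i. if i \<le> n then D x i / N (D x) else 0)" for x
  define p where "p y v = (\<Sum>i\<le>n. (if v = a i then max 0 (y i) else 0) + (if v = b i then max 0 (- y i) else 0))" for y :: "nat \<Rightarrow> real" and v
  define g where "g y = (\<lambda>v. p y v / M y)" for y
  have pa: "p y (a j) = max 0 (y j)" and pb: "p y (b j) = max 0 (- y j)" if "j \<le> n" for y j
  proof -
    have "p y (a j) = (\<Sum>i\<le>n. if i = j then max 0 (y i) else 0)"
      "p y (b j) = (\<Sum>i\<le>n. if i = j then max 0 (- y i) else 0)"
      unfolding p_def using that aeq by (auto intro!: sum.cong)
    then show "p y (a j) = max 0 (y j)" "p y (b j) = max 0 (- y j)" using that by simp_all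
  qed
  have p0: "p y v = 0" if "v \<notin> a ` {..n} \<union> b ` {..n}" for y v
    unfolding p_def using that by (intro sum.neutral) auto
  have N0: "N y > 0 \<longleftrightarrow> (\<exists>i\<le>n. y i \<noteq> 0)" for y
    unfolding N_def by (auto simp: sum_nonneg_eq_0_iff less_le sum_nonneg)
  have M0: "M y > 0 \<longleftrightarrow> (\<exists>i\<le>n. y i \<noteq> 0)" for y
    unfolding M_def by (auto simp: sum_nonneg_eq_0_iff less_le sum_nonneg)
  have bary_cross: "x \<in> bary (cross a b n) \<longleftrightarrow> (\<forall>v. 0 \<le> x v) \<and> (\<forall>v. v \<notin> a ` {..n} \<union> b ` {..n} \<longrightarrow> x v = 0)
     \<and> (\<forall>i\<le>n. x (a i) = 0 \<or> x (b i) = 0) \<and> (\<Sum>i\<le>n. x (a i) + x (b i)) = 1" (is "_ \<longleftrightarrow> ?R") for x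
  proof -
    have sm: "sum x (a ` I \<union> b ` ({..n} - I)) = (\<Sum>i\<le>n. x (a i) + x (b i))"
      if I: "I \<subseteq> {..n}" and z: "\<forall>v. v \<notin> a ` I \<union> b ` ({..n} - I) \<longrightarrow> x v = 0" for I
    proof -
      have "finite I" using I finite_subset by blast
      then have "sum x (a ` I \<union> b ` ({..n} - I)) = sum x (a ` {..n} \<union> b ` {..n})"
        using I z by (intro sum.mono_neutral_left) auto
      also have "\<dots> = sum x (a ` {..n}) + sum x (b ` {..n})"
        using disj by (intro sum.union_disjoint) auto
      also have "\<dots> = (\<Sum>i\<le>n. x (a i) + x (b i))"
        using inj by (simp add: sum.reindex sum.distrib)
      finally show ?thesis .
    qed
    show ?thesis
    proof
      assume "x \<in> bary (cross a b n)"
      then obtain I where I: "I \<subseteq> {..n}" "\<forall>v. v \<notin> a ` I \<union> b ` ({..n} - I) \<longrightarrow> x v = 0"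
        "sum x (a ` I \<union> b ` ({..n} - I)) = 1" "\<forall>v. 0 \<le> x v"
        by (auto simp: bary_def cross_def)
      have "x (a i) = 0 \<or> x (b i) = 0" if "i \<le> n" for i
      proof (cases "i \<in> I")
        case True
        then have "b i \<notin> a ` I \<union> b ` ({..n} - I)"
          using that I(1) aeq by auto
        then show ?thesis using I by blast
      next
        case False
        then have "a i \<notin> a ` I \<union> b ` ({..n} - I)"
          using that I(1) aeq by auto
        then show ?thesis using I by blast
      qed
      moreover have "x v = 0" if "v \<notin> a ` {..n} \<union> b ` {..n}" for v
        using I(1,2) that by (meson Diff_subset Un_mono image_mono subsetD)
      ultimately show ?R using I(3,4) sm[OF I(1,2)] by simp
    next
      assume R: ?R
      define I where "I = {i. i \<le> n \<and> x (a i) \<noteq> 0}"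
      have I: "I \<subseteq> {..n}" by (auto simp: I_def)
      have z: "\<forall>v. v \<notin> a ` I \<union> b ` ({..n} - I) \<longrightarrow> x v = 0"
      proof (intro allI impI)
        fix v assume v: "v \<notin> a ` I \<union> b ` ({..n} - I)"
        show "x v = 0"
        proof (cases "v \<in> a ` {..n} \<union> b ` {..n}")
          case True
          then consider i where "i \<le> n" "v = a i" | i where "i \<le> n" "v = b i" by auto
          then show ?thesis
          proof cases
            case 1 then show ?thesis using v by (auto simp: I_def)
          next
            case 2 then have "i \<in> I" using v by auto
            then show ?thesis using R 2 by (auto simp: I_def)
          qed
        qed (use R in blast)
      qed
      show "x \<in> bary (cross a b n)"
        using sm[OF I z] R z I unfolding bary_def cross_def by auto
    qed
  qed
  have D_props: "\<exists>i\<le>n. D x i \<noteq> 0" "M (D x) = 1" "p (D x) = x" if x: "x \<in> bary (cross a b n)" for x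
  proof -
    note R = x[unfolded bary_cross]
    have "\<bar>D x i\<bar> = x (a i) + x (b i)" if "i \<le> n" for i
      using R that by (auto simp: D_def)
    then have "M (D x) = (\<Sum>i\<le>n. x (a i) + x (b i))" unfolding M_def by (intro sum.cong) auto
    then show M1: "M (D x) = 1" using R by simp
    show "\<exists>i\<le>n. D x i \<noteq> 0" using M0[of "D x"] M1 by simp
    show "p (D x) = x"
    proof
      fix v
      show "p (D x) v = x v"
      proof (cases "v \<in> a ` {..n} \<union> b ` {..n}")
        case True
        then consider i where "i \<le> n" "v = a i" | i where "i \<le> n" "v = b i" by auto
        then show ?thesis
        proof cases
          case 1
          then have "0 \<le> x (a i)" "0 \<le> x (b i)" "x (a i) = 0 \<or> x (b i) = 0" using R by auto
          with 1 show ?thesis by (auto simp: pa D_def)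
        next
          case 2
          then have "0 \<le> x (a i)" "0 \<le> x (b i)" "x (a i) = 0 \<or> x (b i) = 0" using R by auto
          with 2 show ?thesis by (auto simp: pb D_def)
        qed
      next
        case False
        then show ?thesis using p0[OF False] R by auto
      qed
    qed
  qed
  have scale_p: "p (\<lambda>i. c * y i) v = c * p y v" if "0 \<le> c" for c y v
  proof -
    have "max 0 (c * t) = c * max 0 t" "max 0 (- (c * t)) = c * max 0 (- t)" for t :: real
      using that by (auto simp: max_def zero_le_mult_iff mult_le_0_iff)
    then show ?thesis unfolding p_def sum_distrib_left by (intro sum.cong) (auto simp: distrib_left)
  qed
  have p_cong: "p y = p y'" if "\<And>i. i \<le> n \<Longrightarrow> y i = y' i" for y y'
    unfolding p_def using that by (intro ext sum.cong) auto
  have M_cong: "M y = M y'" if "\<And>i. i \<le> n \<Longrightarrow> y i = y' i" for y y'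
    unfolding M_def using that by (intro sum.cong) auto
  have scale_M: "M (\<lambda>i. c * y i) = c * M y" if "0 \<le> c" for c y
    using that by (simp add: M_def abs_mult sum_distrib_left)
  have scale_N: "N (\<lambda>i. c * y i) = c * N y" if "0 \<le> c" for c y
    using that by (simp add: N_def power_mult_distrib real_sqrt_mult flip: sum_distrib_left)
  let ?S = "{y. (\<Sum>i\<le>n. (y i)\<^sup>2) = 1 \<and> (\<forall>i>n. y i = (0::real))}"
  have S_N: "(\<Sum>i\<le>n. (y i)\<^sup>2) = 1 \<longleftrightarrow> N y = 1" for y
    by (auto simp: N_def)
  have f_in: "f x \<in> ?S" and gf: "g (f x) = x" if x: "x \<in> bary (cross a b n)" for x
  proof -
    have Np: "N (D x) > 0" using D_props(1)[OF x] N0 by blast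
    define c where "c = 1 / N (D x)"
    have c: "c > 0" using Np by (simp add: c_def)
    have fx: "f x i = c * D x i" if "i \<le> n" for i using that by (simp add: f_def c_def)
    have "N (f x) = N (\<lambda>i. c * D x i)" unfolding N_def by (auto simp: fx intro!: arg_cong[where f=sqrt] sum.cong)
    also have "\<dots> = 1" using c scale_N[of c] Np by (simp add: c_def)
    finally show "f x \<in> ?S" using S_N by (auto simp: f_def)
    have "p (f x) = p (\<lambda>i. c * D x i)" "M (f x) = M (\<lambda>i. c * D x i)"
      using fx by (auto intro!: p_cong M_cong)
    then show "g (f x) = x"
      using c scale_p[of c "D x"] scale_M[of c "D x"] D_props[OF x] by (auto simp: g_def)
  qed
  have g_in: "g y \<in> bary (cross a b n)" and fg: "f (g y) = y" if y: "y \<in> ?S" for y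
  proof -
    have N1: "N y = 1" using y S_N by auto
    then have Mp: "M y > 0" using N0[of y] M0[of y] by auto
    define c where "c = 1 / M y"
    have c: "c > 0" using Mp by (simp add: c_def)
    have ga: "g y (a i) = max 0 (y i) / M y" "g y (b i) = max 0 (- y i) / M y" if "i \<le> n" for i
      using that by (auto simp: g_def pa pb)
    have D: "D (g y) i = c * y i" if "i \<le> n" for i
      using that by (auto simp: D_def ga c_def max_def)
    have "N (D (g y)) = N (\<lambda>i. c * y i)" unfolding N_def by (auto simp: D intro!: arg_cong[where f=sqrt] sum.cong)
    also have "\<dots> = c" using c scale_N[of c] N1 by simp
    finally have Nc: "N (D (g y)) = c" .
    show "f (g y) = y"
      using y c D by (auto simp: f_def fun_eq_iff Nc not_le)
    have "(\<Sum>i\<le>n. g y (a i) + g y (b i)) = (\<Sum>i\<le>n. \<bar>y i\<bar> / M y)"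
      by (intro sum.cong) (auto simp: ga max_def)
    also have "\<dots> = 1" using Mp by (simp add: M_def flip: sum_divide_distrib)
    finally have sm: "(\<Sum>i\<le>n. g y (a i) + g y (b i)) = 1" .
    have "p y v \<ge> 0" for v unfolding p_def by (intro sum_nonneg) auto
    then have "0 \<le> g y v" for v using Mp by (simp add: g_def)
    moreover have "g y v = 0" if "v \<notin> a ` {..n} \<union> b ` {..n}" for v
      using p0[OF that] by (simp add: g_def)
    moreover have "g y (a i) = 0 \<or> g y (b i) = 0" if "i \<le> n" for i
      using that by (auto simp: ga max_def)
    ultimately show "g y \<in> bary (cross a b n)" unfolding bary_cross using sm by blast
  qed
  have cf: "continuous_map (subtopology (powertop_real UNIV) (bary (cross a b n))) (powertop_real UNIV) f"
    unfolding continuous_map_componentwise_UNIV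
  proof
    fix k
    have cD: "continuous_map (subtopology (powertop_real UNIV) (bary (cross a b n))) euclideanreal (\<lambda>x. D x i)" for i
      unfolding D_def by (intro continuous_intros continuous_map_from_subtopology) auto
    have cN: "continuous_map (subtopology (powertop_real UNIV) (bary (cross a b n))) euclideanreal (\<lambda>x. N (D x))"
      unfolding N_def using cD by (intro continuous_intros) auto
    have "N (D x) \<noteq> 0" if "x \<in> bary (cross a b n)" for x
      using D_props(1)[OF that] N0[of "D x"] by auto
    then show "continuous_map (subtopology (powertop_real UNIV) (bary (cross a b n))) euclideanreal (\<lambda>x. f x k)"
      unfolding f_def using cD cN by (auto intro!: continuous_map_real_divide)
  qed
  have cg: "continuous_map (subtopology (powertop_real UNIV) ?S) (powertop_real UNIV) g"
    unfolding continuous_map_componentwise_UNIV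
  proof
    fix k
    let ?X = "subtopology (powertop_real UNIV) ?S"
    have c1: "continuous_map ?X euclideanreal (\<lambda>x. x i)" for i
      by (intro continuous_map_from_subtopology continuous_map_product_projection) auto
    have cp: "continuous_map ?X euclideanreal (\<lambda>x. p x k)"
    proof -
      have "continuous_map ?X euclideanreal (\<lambda>x. if c then max 0 (x i) else 0)" 
           "continuous_map ?X euclideanreal (\<lambda>x. if c then max 0 (- x i) else 0)" for c i
        using c1 by (cases c; auto intro!: continuous_intros continuous_map_real_max continuous_map_minus)+
      then show ?thesis unfolding p_def by (intro continuous_map_sum continuous_map_add) auto
    qed
    have cM: "continuous_map ?X euclideanreal M"
      unfolding M_def[abs_def] using c1 by (intro continuous_map_sum continuous_map_real_abs) auto
    have "M y \<noteq> 0" if "y \<in> ?S" for y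
      using that S_N[of y] N0[of y] M0[of y] by auto
    then show "continuous_map ?X euclideanreal (\<lambda>x. g x k)"
      unfolding g_def using cp cM by (intro continuous_map_real_divide) auto
  qed
  have "homeomorphic_maps (subtopology (powertop_real UNIV) (bary (cross a b n))) (subtopology (powertop_real UNIV) ?S) f g"
    unfolding homeomorphic_maps_def
    using f_in g_in fg gf cf cg
    by (auto simp: continuous_map_in_subtopology)
  then show ?thesis
    using geometric_realization_faces[OF fin] nsphere homeomorphic_space_def by metis
qed

section \<open>Bistellar flips\<close>

text \<open>Equal cardinality makes \<open>F\<close> an antichain, so that \<open>F\<close> is
  exactly the set of facets of \<open>faces F\<close>.\<close>

definition facet_sphere :: "nat \<Rightarrow> 'a set set \<Rightarrow> bool" where
  "facet_sphere d F \<longleftrightarrow> finite F \<and> (\<forall>\<sigma>\<in>F. finite \<sigma> \<and> card \<sigma> = Suc d) \<and>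
     geometric_realization (faces F) homeomorphic_space nsphere d"

lemma facet_sphere_stellar:
  assumes F: "facet_sphere d F" and A: "finite A" "A \<noteq> {}" and v: "v \<notin> \<Union>F" "v \<notin> A"
  shows "facet_sphere d (stellar A v F)"
proof -
  have "stellar A v F \<subseteq> F \<union> (\<lambda>(\<sigma>, f). insert v (\<sigma> - {f})) ` (F \<times> A)"
    by (auto simp: stellar_def)
  then have "finite (stellar A v F)"
    using F A finite_subset by (fastforce simp: facet_sphere_def)
  moreover have "finite \<sigma> \<and> card \<sigma> = Suc d" if "\<sigma> \<in> stellar A v F" for \<sigma>
    using that F v unfolding stellar_def facet_sphere_def
    by (auto simp: card_insert_if card_Diff_singleton_if)
  moreover have "geometric_realization (faces (stellar A v F)) homeomorphic_space nsphere d"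
  proof -
    have "geometric_realization (faces F) homeomorphic_space geometric_realization (faces (stellar A v F))"
      using F A v by (intro geometric_realization_stellar) (auto simp: facet_sphere_def)
    then show ?thesis
      using F unfolding facet_sphere_def by (meson homeomorphic_space_sym homeomorphic_space_trans)
  qed
  ultimately show ?thesis by (simp add: facet_sphere_def)
qed

text \<open>Exchanges \<open>A * \<partial>B * L\<close> for \<open>\<partial>A * B * L\<close>: the subdivisions of the two complexes at \<open>A\<close> and at \<open>B\<close>
  coincide.\<close>

lemma facet_sphere_flip:
  fixes P :: "nat set set"
  assumes S: "facet_sphere d (P \<union> (\<Union>l\<in>L. (\<lambda>g. A \<union> (B - {g}) \<union> l) ` B))"
    and fin: "finite A" "A \<noteq> {}" "finite B" "B \<noteq> {}" "finite L"
    and disj: "A \<inter> B = {}" "\<And>l. l \<in> L \<Longrightarrow> l \<inter> (A \<union> B) = {}"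
    and nA: "\<And>\<sigma>. \<sigma> \<in> P \<Longrightarrow> \<not> A \<subseteq> \<sigma>" and nB: "\<And>\<sigma>. \<sigma> \<in> P \<Longrightarrow> \<not> B \<subseteq> \<sigma>"
  shows "facet_sphere d (P \<union> (\<Union>l\<in>L. (\<lambda>f. (A - {f}) \<union> B \<union> l) ` A))"
    (is "facet_sphere d ?F'")
proof -
  let ?F = "P \<union> (\<Union>l\<in>L. (\<lambda>g. A \<union> (B - {g}) \<union> l) ` B)"
  have SF: "finite ?F" "\<And>\<sigma>. \<sigma> \<in> ?F \<Longrightarrow> finite \<sigma> \<and> card \<sigma> = Suc d"
    using conjunct1[OF S[unfolded facet_sphere_def]]
      bspec[OF conjunct1[OF conjunct2[OF S[unfolded facet_sphere_def]]]] by this+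
  obtain b where b: "b \<in> B" using fin by blast
  have fc: "finite \<sigma> \<and> card \<sigma> = Suc d" if "\<sigma> \<in> ?F'" for \<sigma>
    using that
  proof
    assume "\<sigma> \<in> (\<Union>l\<in>L. (\<lambda>f. (A - {f}) \<union> B \<union> l) ` A)"
    then obtain l f where lf: "l \<in> L" "f \<in> A" "\<sigma> = (A - {f}) \<union> B \<union> l" by blast
    have "A \<union> (B - {b}) \<union> l \<in> ?F" using lf b by blast
    then have *: "finite (A \<union> (B - {b}) \<union> l)" "card (A \<union> (B - {b}) \<union> l) = Suc d" using SF(2) by blast+
    \<comment> \<open>Exchanging \<open>b\<close> for \<open>f\<close> turns the new facet into an
      old one, so both have the same size.\<close>
    have e: "insert f (\<sigma> - {b}) = A \<union> (B - {b}) \<union> l" and f: "f \<notin> \<sigma>" and b: "b \<in> \<sigma>"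
      using lf b disj by auto
    have fin\<sigma>: "finite \<sigma>" using *(1) unfolding e[symmetric] by simp
    have "card \<sigma> = Suc (card (\<sigma> - {b}))" using card.remove[OF fin\<sigma> b] .
    also have "\<dots> = card (insert f (\<sigma> - {b}))" using fin\<sigma> f by simp
    finally show ?thesis using * fin\<sigma> e by simp
  qed (use SF in blast)
  have finF': "finite ?F'" using SF(1) fin by auto
  \<comment> \<open>One vertex that is fresh for both complexes serves for both
    subdivisions.\<close>
  have "finite (\<Union>(?F \<union> ?F') \<union> A \<union> B)"
    using SF finF' fc fin by (intro finite_UnI finite_Union) auto
  then obtain v where "v \<notin> \<Union>(?F \<union> ?F') \<union> A \<union> B"
    using infinite_nat_iff_unbounded ex_new_if_finite by (metis infinite_UNIV_nat)
  then have v: "v \<notin> \<Union>?F" "v \<notin> \<Union>?F'" "v \<notin> A" "v \<notin> B" by auto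
  \<comment> \<open>Both subdivisions consist of \<open>P\<close> and the join of \<open>v\<close>,
    the boundaries of \<open>A\<close> and \<open>B\<close>, and \<open>L\<close>, which is
    symmetric in \<open>A\<close> and \<open>B\<close>.\<close>
  have eq1: "stellar A v ?F = P \<union> {insert v ((A - {f}) \<union> (B - {g}) \<union> l) | f g l. f \<in> A \<and> g \<in> B \<and> l \<in> L}"
  proof -
    have "insert v (A \<union> (B - {g}) \<union> l - {f}) = insert v ((A - {f}) \<union> (B - {g}) \<union> l)"
      if "f \<in> A" "g \<in> B" "l \<in> L" for f g l
      using that disj by auto
    note eq = this
    have 1: "{\<sigma> \<in> ?F. \<not> A \<subseteq> \<sigma>} = P" using nA by auto
    have 2: "{insert v (\<sigma> - {h}) |\<sigma> h. \<sigma> \<in> ?F \<and> A \<subseteq> \<sigma> \<and> h \<in> A} =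
      {insert v ((A - {f}) \<union> (B - {g}) \<union> l) | f g l. f \<in> A \<and> g \<in> B \<and> l \<in> L}"
    proof (intro set_eqI iffI)
      fix \<tau> assume "\<tau> \<in> {insert v (\<sigma> - {h}) |\<sigma> h. \<sigma> \<in> ?F \<and> A \<subseteq> \<sigma> \<and> h \<in> A}"
      then obtain \<sigma> f where s: "\<tau> = insert v (\<sigma> - {f})" "\<sigma> \<in> ?F" "A \<subseteq> \<sigma>" "f \<in> A" by blast
      then have "\<sigma> \<notin> P" using nA by blast
      then obtain g l where t: "g \<in> B" "l \<in> L" "\<sigma> = A \<union> (B - {g}) \<union> l" using s(2) by blast
      then have "\<tau> = insert v ((A - {f}) \<union> (B - {g}) \<union> l)" using s eq by simp
      then show "\<tau> \<in> {insert v ((A - {f}) \<union> (B - {g}) \<union> l) | f g l. f \<in> A \<and> g \<in> B \<and> l \<in> L}"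
        using s(4) t(1,2) by (intro CollectI exI conjI)
    next
      fix \<tau> assume "\<tau> \<in> {insert v ((A - {f}) \<union> (B - {g}) \<union> l) | f g l. f \<in> A \<and> g \<in> B \<and> l \<in> L}"
      then obtain f g l where t: "\<tau> = insert v ((A - {f}) \<union> (B - {g}) \<union> l)" "f \<in> A" "g \<in> B" "l \<in> L" by (elim CollectE exE conjE)
      then have 1: "\<tau> = insert v (A \<union> (B - {g}) \<union> l - {f})" using eq by simp
      have 2: "A \<union> (B - {g}) \<union> l \<in> ?F" using t by (intro UnI2 UN_I[of l] image_eqI[of _ _ g] refl)
      have 3: "A \<subseteq> A \<union> (B - {g}) \<union> l" by auto
      show "\<tau> \<in> {insert v (\<sigma> - {h}) |\<sigma> h. \<sigma> \<in> ?F \<and> A \<subseteq> \<sigma> \<and> h \<in> A}"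
        using t(2,3) by (intro CollectI exI conjI) (rule 1, rule 2, rule 3, assumption)
    qed
    show ?thesis unfolding stellar_def 1 2 by (rule refl)
  qed
  have eq2: "stellar B v ?F' = P \<union> {insert v ((A - {f}) \<union> (B - {g}) \<union> l) | f g l. f \<in> A \<and> g \<in> B \<and> l \<in> L}"
  proof -
    have "insert v ((A - {f}) \<union> B \<union> l - {g}) = insert v ((A - {f}) \<union> (B - {g}) \<union> l)"
      if "f \<in> A" "g \<in> B" "l \<in> L" for f g l
      using that disj by auto
    note eq = this
    have 1: "{\<sigma> \<in> ?F'. \<not> B \<subseteq> \<sigma>} = P" using nB by auto
    have 2: "{insert v (\<sigma> - {h}) |\<sigma> h. \<sigma> \<in> ?F' \<and> B \<subseteq> \<sigma> \<and> h \<in> B} =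
      {insert v ((A - {f}) \<union> (B - {g}) \<union> l) | f g l. f \<in> A \<and> g \<in> B \<and> l \<in> L}"
    proof (intro set_eqI iffI)
      fix \<tau> assume "\<tau> \<in> {insert v (\<sigma> - {h}) |\<sigma> h. \<sigma> \<in> ?F' \<and> B \<subseteq> \<sigma> \<and> h \<in> B}"
      then obtain \<sigma> g where s: "\<tau> = insert v (\<sigma> - {g})" "\<sigma> \<in> ?F'" "B \<subseteq> \<sigma>" "g \<in> B" by blast
      then have "\<sigma> \<notin> P" using nB by blast
      then obtain f l where t: "f \<in> A" "l \<in> L" "\<sigma> = (A - {f}) \<union> B \<union> l" using s(2) by blast
      then have "\<tau> = insert v ((A - {f}) \<union> (B - {g}) \<union> l)" using s eq by simp
      then show "\<tau> \<in> {insert v ((A - {f}) \<union> (B - {g}) \<union> l) | f g l. f \<in> A \<and> g \<in> B \<and> l \<in> L}"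
        using s(4) t(1,2) by (intro CollectI exI conjI)
    next
      fix \<tau> assume "\<tau> \<in> {insert v ((A - {f}) \<union> (B - {g}) \<union> l) | f g l. f \<in> A \<and> g \<in> B \<and> l \<in> L}"
      then obtain f g l where t: "\<tau> = insert v ((A - {f}) \<union> (B - {g}) \<union> l)" "f \<in> A" "g \<in> B" "l \<in> L" by (elim CollectE exE conjE)
      then have 1: "\<tau> = insert v ((A - {f}) \<union> B \<union> l - {g})" using eq by simp
      have 2: "(A - {f}) \<union> B \<union> l \<in> ?F'" using t by (intro UnI2 UN_I[of l] image_eqI[of _ _ f] refl)
      have 3: "B \<subseteq> (A - {f}) \<union> B \<union> l" by auto
      show "\<tau> \<in> {insert v (\<sigma> - {h}) |\<sigma> h. \<sigma> \<in> ?F' \<and> B \<subseteq> \<sigma> \<and> h \<in> B}"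
        using t(2,3) by (intro CollectI exI conjI) (rule 1, rule 2, rule 3, assumption)
    qed
    show ?thesis unfolding stellar_def 1 2 by (rule refl)
  qed
  have "geometric_realization (faces ?F) homeomorphic_space geometric_realization (faces (stellar A v ?F))"
    using SF v fin by (intro geometric_realization_stellar) auto
  moreover have "geometric_realization (faces ?F') homeomorphic_space geometric_realization (faces (stellar B v ?F'))"
    using fc v fin by (intro geometric_realization_stellar) auto
  moreover have "geometric_realization (faces ?F) homeomorphic_space nsphere d"
    using S by (simp add: facet_sphere_def)
  ultimately have "geometric_realization (faces ?F') homeomorphic_space nsphere d"
    unfolding eq1 eq2 by (meson homeomorphic_space_sym homeomorphic_space_trans)
  then show ?thesis using finF' fc unfolding facet_sphere_def by blast
qed

section \<open>Flips along a path and over a disc\<close>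

lemma flip_2_4:
  fixes P :: "nat set set"
  assumes S: "facet_sphere 4 (P \<union> {{x1,x2,x3,x4,y1}, {x1,x2,x3,x4,y2}})"
    and d: "distinct [x1,x2,x3,x4,y1,y2]"
    and nA: "\<And>\<sigma>. \<sigma> \<in> P \<Longrightarrow> \<not> {x1,x2,x3,x4} \<subseteq> \<sigma>" and nB: "\<And>\<sigma>. \<sigma> \<in> P \<Longrightarrow> \<not> {y1,y2} \<subseteq> \<sigma>"
  shows "facet_sphere 4 (P \<union> {{x2,x3,x4,y1,y2}, {x1,x3,x4,y1,y2}, {x1,x2,x4,y1,y2}, {x1,x2,x3,y1,y2}})"
proof -
  have 1: "(\<Union>l\<in>{{}}. (\<lambda>g. {x1,x2,x3,x4} \<union> ({y1,y2} - {g}) \<union> l) ` {y1,y2}) = {{x1,x2,x3,x4,y1}, {x1,x2,x3,x4,y2}}"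
    using d by (auto simp: insert_Diff_if)
  have 2: "(\<Union>l\<in>{{}}. (\<lambda>f. ({x1,x2,x3,x4} - {f}) \<union> {y1,y2} \<union> l) ` {x1,x2,x3,x4}) =
     {{x2,x3,x4,y1,y2}, {x1,x3,x4,y1,y2}, {x1,x2,x4,y1,y2}, {x1,x2,x3,y1,y2}}"
  proof -
    have "{x1,x2,x3,x4} - {x1} = {x2,x3,x4}" "{x1,x2,x3,x4} - {x2} = {x1,x3,x4}"
      "{x1,x2,x3,x4} - {x3} = {x1,x2,x4}" "{x1,x2,x3,x4} - {x4} = {x1,x2,x3}"
      using d by auto
    then show ?thesis by (simp add: insert_commute)
  qed
  show ?thesis
    using facet_sphere_flip[where d=4 and P=P and L="{{}}" and A="{x1,x2,x3,x4}" and B="{y1,y2}"] S d nA nB unfolding 1 2 by auto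
qed

lemma flip_3_3:
  fixes P :: "nat set set"
  assumes S: "facet_sphere 4 (P \<union> {{x1,x2,x3,y1,y2}, {x1,x2,x3,y1,y3}, {x1,x2,x3,y2,y3}})"
    and d: "distinct [x1,x2,x3,y1,y2,y3]"
    and nA: "\<And>\<sigma>. \<sigma> \<in> P \<Longrightarrow> \<not> {x1,x2,x3} \<subseteq> \<sigma>" and nB: "\<And>\<sigma>. \<sigma> \<in> P \<Longrightarrow> \<not> {y1,y2,y3} \<subseteq> \<sigma>"
  shows "facet_sphere 4 (P \<union> {{x1,x2,y1,y2,y3}, {x1,x3,y1,y2,y3}, {x2,x3,y1,y2,y3}})"
proof -
  have 1: "(\<Union>l\<in>{{}}. (\<lambda>g. {x1,x2,x3} \<union> ({y1,y2,y3} - {g}) \<union> l) ` {y1,y2,y3}) = {{x1,x2,x3,y1,y2}, {x1,x2,x3,y1,y3}, {x1,x2,x3,y2,y3}}"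
    using d by (auto simp: insert_Diff_if)
  have 2: "(\<Union>l\<in>{{}}. (\<lambda>f. ({x1,x2,x3} - {f}) \<union> {y1,y2,y3} \<union> l) ` {x1,x2,x3}) =
     {{x1,x2,y1,y2,y3}, {x1,x3,y1,y2,y3}, {x2,x3,y1,y2,y3}}"
    using d by (auto simp: insert_Diff_if)
  show ?thesis
    using facet_sphere_flip[where d=4 and P=P and L="{{}}" and A="{x1,x2,x3}" and B="{y1,y2,y3}"] S d nA nB unfolding 1 2 by auto
qed

text \<open>With \<open>A = {a1, a2}\<close>, \<open>B = {b1, b2}\<close> and the path \<open>Q = [c..e]\<close>, this exchanges \<open>A * \<partial>B * Q\<close> for
  \<open>\<partial>A * B * Q \<union> A * B * \<partial>Q\<close>, by one flip for each edge of \<open>Q\<close>.\<close>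

lemma path_flip:
  fixes P :: "nat set set"
  assumes S: "facet_sphere 4 (P \<union> (\<Union>j\<in>{c..<e}. {{a1,a2,b1,j,Suc j}, {a1,a2,b2,j,Suc j}}))"
    and ce: "c < e" and d: "distinct [a1,a2,b1,b2]" "{a1,a2,b1,b2} \<inter> {c..e} = {}"
    and nA: "\<And>\<sigma> j. \<sigma> \<in> P \<Longrightarrow> c \<le> j \<Longrightarrow> j < e \<Longrightarrow> \<not> {a1,a2,j,Suc j} \<subseteq> \<sigma>"
    and nA': "\<And>\<sigma> j. \<sigma> \<in> P \<Longrightarrow> c < j \<Longrightarrow> j < e \<Longrightarrow> \<not> {a1,a2,j} \<subseteq> \<sigma>"
    and nB: "\<And>\<sigma>. \<sigma> \<in> P \<Longrightarrow> \<not> {b1,b2} \<subseteq> \<sigma>"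
  shows "facet_sphere 4 (P \<union> (\<Union>j\<in>{c..<e}. {{a1,b1,b2,j,Suc j}, {a2,b1,b2,j,Suc j}}) \<union>
    {{a1,a2,b1,b2,c}, {a1,a2,b1,b2,e}})"
proof -
  define old where "old j = {{a1,a2,b1,j,Suc j}, {a1,a2,b2,j,Suc j}}" for j
  define new where "new j = {{a1,b1,b2,j,Suc j}, {a2,b1,b2,j,Suc j}}" for j
  define full where "full j = {a1,a2,b1,b2,j}" for j
  have ne: "a1 \<noteq> j" "a2 \<noteq> j" "b1 \<noteq> j" "b2 \<noteq> j" if "c \<le> j" "j \<le> e" for j
    using that d(2) by auto
  have ne': "a1 \<noteq> a2" "b1 \<noteq> b2" "a1 \<noteq> b1" "a1 \<noteq> b2" "a2 \<noteq> b1" "a2 \<noteq> b2" "b1 \<noteq> a1" "b2 \<noteq> a1" "b1 \<noteq> a2" "b2 \<noteq> a2"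
    using d(1) by auto
  \<comment> \<open>Invariant: the edges before \<open>k\<close> are exchanged, and
    \<open>full c\<close>, \<open>full k\<close> cap the exchanged stretch. The first edge takes a
    2-4 flip, which creates the caps; each later edge takes a 3-3 flip with \<open>full k\<close> as
    the third facet, which moves the cap to \<open>full (Suc k)\<close>.\<close>
  have "facet_sphere 4 (P \<union> \<Union>(old ` {k..<e}) \<union> \<Union>(new ` {c..<k}) \<union> {full c, full k})"
    if "Suc c \<le> k" "k \<le> e" for k
    using that
  proof (induction k rule: dec_induct)
    case base
    have "{c..<e} = insert c {Suc c..<e}" using ce by auto
    then have "P \<union> \<Union>(old ` {c..<e}) = P \<union> \<Union>(old ` {Suc c..<e}) \<union> old c" by auto
    also have "old c = {{a1,a2,c,Suc c,b1}, {a1,a2,c,Suc c,b2}}"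
    proof -
      have "{a1,a2,c,Suc c,b1} = {a1,a2,b1,c,Suc c}" "{a1,a2,c,Suc c,b2} = {a1,a2,b2,c,Suc c}" by auto
      then show ?thesis unfolding old_def by simp
    qed
    finally have S': "facet_sphere 4 (P \<union> \<Union>(old ` {Suc c..<e}) \<union> {{a1,a2,c,Suc c,b1}, {a1,a2,c,Suc c,b2}})"
      using S unfolding old_def[symmetric] by simp
    have "facet_sphere 4 (P \<union> \<Union>(old ` {Suc c..<e}) \<union>
      {{a2,c,Suc c,b1,b2}, {a1,c,Suc c,b1,b2}, {a1,a2,Suc c,b1,b2}, {a1,a2,c,b1,b2}})"
    proof (rule flip_2_4[OF S'])
      show "distinct [a1, a2, c, Suc c, b1, b2]" using ne[of c] ne[of "Suc c"] ne' ce by simp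
      show "\<not> {a1, a2, c, Suc c} \<subseteq> \<sigma>" if s: "\<sigma> \<in> P \<union> \<Union> (old ` {Suc c..<e})" for \<sigma>
      proof (cases "\<sigma> \<in> P")
        case False
        then obtain j where "Suc c \<le> j" "\<sigma> \<in> old j" using s by auto
        then have "c \<notin> \<sigma>" using ne[of c] ce by (auto simp: old_def)
        then show ?thesis by blast
      qed (use nA[of \<sigma> c] ce in simp)
      show "\<not> {b1,b2} \<subseteq> \<sigma>" if s: "\<sigma> \<in> P \<union> \<Union> (old ` {Suc c..<e})" for \<sigma>
      proof (cases "\<sigma> \<in> P")
        case False
        then obtain j where "Suc c \<le> j" "j < e" "\<sigma> \<in> old j" using s by auto
        then show ?thesis using ne[of j] ne[of "Suc j"] ne' by (auto simp: old_def)
      qed (use nB in simp)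
    qed
    also have "{{a2,c,Suc c,b1,b2}, {a1,c,Suc c,b1,b2}, {a1,a2,Suc c,b1,b2}, {a1,a2,c,b1,b2}} =
      new c \<union> {full c, full (Suc c)}"
    proof -
      have "{a2,c,Suc c,b1,b2} = {a2,b1,b2,c,Suc c}" "{a1,c,Suc c,b1,b2} = {a1,b1,b2,c,Suc c}"
        "{a1,a2,Suc c,b1,b2} = full (Suc c)" "{a1,a2,c,b1,b2} = full c"
        unfolding full_def by auto
      then show ?thesis unfolding new_def by auto
    qed
    finally show ?case by (simp add: Un_assoc)
  next
    case (step k)
    then have IH: "facet_sphere 4 (P \<union> \<Union>(old ` {k..<e}) \<union> \<Union>(new ` {c..<k}) \<union> {full c, full k})" by simp
    let ?P = "P \<union> \<Union>(old ` {Suc k..<e}) \<union> \<Union>(new ` {c..<k}) \<union> {full c}"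
    have "{k..<e} = insert k {Suc k..<e}" using step by auto
    then have "P \<union> \<Union>(old ` {k..<e}) \<union> \<Union>(new ` {c..<k}) \<union> {full c, full k} = ?P \<union> (old k \<union> {full k})" by auto
    also have "old k \<union> {full k} = {{a1,a2,k,b1,b2}, {a1,a2,k,b1,Suc k}, {a1,a2,k,b2,Suc k}}"
    proof -
      have "{a1,a2,k,b1,b2} = full k" "{a1,a2,k,b1,Suc k} = {a1,a2,b1,k,Suc k}" "{a1,a2,k,b2,Suc k} = {a1,a2,b2,k,Suc k}"
        unfolding full_def by auto
      then show ?thesis unfolding old_def by auto
    qed

    finally have S': "facet_sphere 4 (?P \<union> {{a1,a2,k,b1,b2}, {a1,a2,k,b1,Suc k}, {a1,a2,k,b2,Suc k}})" using IH by simp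
    have "facet_sphere 4 (?P \<union> {{a1,a2,b1,b2,Suc k}, {a1,k,b1,b2,Suc k}, {a2,k,b1,b2,Suc k}})"
    proof (rule flip_3_3[OF S'])
      have ck: "c < k" "k < e" using step by auto
      show "distinct [a1, a2, k, b1, b2, Suc k]" using ne[of k] ne[of "Suc k"] ne' ck by simp
      fix \<sigma> assume s: "\<sigma> \<in> ?P"
      consider "\<sigma> \<in> P" | j where "Suc k \<le> j" "j < e" "\<sigma> \<in> old j" | j where "c \<le> j" "j < k" "\<sigma> \<in> new j" | "\<sigma> = full c"
        using s by auto
      then have "\<not> {a1, a2, k} \<subseteq> \<sigma> \<and> \<not> {b1, b2, Suc k} \<subseteq> \<sigma>"
      proof cases
        case 1 then show ?thesis using nA'[of \<sigma> k] nB[of \<sigma>] ck by auto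
      next
        case (2 j) then show ?thesis using ne[of k] ne[of j] ne[of "Suc j"] ne' ck by (auto simp: old_def)
      next
        case (3 j) then show ?thesis using ne[of "Suc k"] ne[of j] ne[of "Suc j"] ne' ck by (auto simp: new_def)
      next
        case 4 then show ?thesis using ne[of k] ne[of "Suc k"] ck by (auto simp: full_def)
      qed
      then show "\<not> {a1, a2, k} \<subseteq> \<sigma>" "\<not> {b1, b2, Suc k} \<subseteq> \<sigma>" by auto
    qed
    also have "{{a1,a2,b1,b2,Suc k}, {a1,k,b1,b2,Suc k}, {a2,k,b1,b2,Suc k}} = {full (Suc k)} \<union> new k"
    proof -
      have "{a1,k,b1,b2,Suc k} = {a1,b1,b2,k,Suc k}" "{a2,k,b1,b2,Suc k} = {a2,b1,b2,k,Suc k}" by auto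
      then show ?thesis unfolding new_def full_def by auto
    qed
    also have "?P \<union> ({full (Suc k)} \<union> new k) =
      P \<union> \<Union>(old ` {Suc k..<e}) \<union> \<Union>(new ` {c..<Suc k}) \<union> {full c, full (Suc k)}"
    proof -
      have "{c..<Suc k} = insert k {c..<k}" using step by auto
      then show ?thesis by auto
    qed
    finally show ?case .
  qed
  from this[of e] ce show ?thesis by (simp add: new_def full_def)
qed

lemma UN_doubleton: "(\<Union>j\<in>J. {f j, g j}) = f ` J \<union> g ` J"
  by auto

text \<open>The disc \<open>w * [r..e]\<close> is retriangulated by the triangle \<open>{w, r, e}\<close> and the fan with apex \<open>r\<close>, one
  diagonal at a time, simultaneously over the path \<open>[c..d]\<close>.\<close>

lemma fan_flip:
  fixes P :: "nat set set"
  assumes S: "facet_sphere 4 (P \<union> (\<Union>i\<in>{r..<e}. (\<lambda>j. {w,i,Suc i,j,Suc j}) ` {c..<d}))"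
    and ord: "w < c" "c < d" "d < r" "r < e"
    and nA: "\<And>\<sigma> i j. \<sigma> \<in> P \<Longrightarrow> r < i \<Longrightarrow> i < e \<Longrightarrow> c \<le> j \<Longrightarrow> j < d \<Longrightarrow> \<not> {w,i,j,Suc j} \<subseteq> \<sigma>"
    and nA': "\<And>\<sigma> i j. \<sigma> \<in> P \<Longrightarrow> r < i \<Longrightarrow> i < e \<Longrightarrow> c < j \<Longrightarrow> j < d \<Longrightarrow> \<not> {w,i,j} \<subseteq> \<sigma>"
    and nB: "\<And>\<sigma> i. \<sigma> \<in> P \<Longrightarrow> Suc r < i \<Longrightarrow> i \<le> e \<Longrightarrow> \<not> {r,i} \<subseteq> \<sigma>"
  shows "facet_sphere 4 (P \<union> (\<lambda>j. {w,r,e,j,Suc j}) ` {c..<d} \<union>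
    (\<Union>i\<in>{Suc r..<e}. (\<lambda>j. {r,i,Suc i,j,Suc j}) ` {c..<d}) \<union>
    (\<Union>i\<in>{Suc r..<e}. {{w,r,i,Suc i,c}, {w,r,i,Suc i,d}}))"
proof -
  define row where "row i = (\<lambda>j. {w,i,Suc i,j,Suc j}) ` {c..<d}" for i
  define tri where "tri i = (\<lambda>j. {w,r,i,j,Suc j}) ` {c..<d}" for i
  define fan where "fan i = (\<lambda>j. {r,i,Suc i,j,Suc j}) ` {c..<d}" for i
  define wall where "wall i = {{w,r,i,Suc i,c}, {w,r,i,Suc i,d}}" for i
  \<comment> \<open>Invariant: \<open>tri k\<close> separates the finished fan from the remaining
    rows, and \<open>wall\<close> collects what the path flips leave over the two ends of the path.
    At \<open>k = Suc r\<close> nothing has been done, as \<open>row r\<close> already is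
    \<open>tri (Suc r)\<close>.\<close>
  have "facet_sphere 4 (P \<union> \<Union>(row ` {k..<e}) \<union> tri k \<union> \<Union>(fan ` {Suc r..<k}) \<union> \<Union>(wall ` {Suc r..<k}))"
    if "Suc r \<le> k" "k \<le> e" for k
    using that
  proof (induction k rule: dec_induct)
    case base
    have "{r..<e} = insert r {Suc r..<e}" using ord by auto
    moreover have "row r = tri (Suc r)" by (simp add: row_def tri_def)
    ultimately show ?case using S unfolding row_def[symmetric] by (simp add: Un_ac)
  next
    case (step k)
    let ?P = "P \<union> \<Union>(row ` {Suc k..<e}) \<union> \<Union>(fan ` {Suc r..<k}) \<union> \<Union>(wall ` {Suc r..<k})"
    have k: "r < k" "k < e" using step by auto
    have "{k..<e} = insert k {Suc k..<e}" using k by auto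
    then have "P \<union> \<Union>(row ` {k..<e}) \<union> tri k \<union> \<Union>(fan ` {Suc r..<k}) \<union> \<Union>(wall ` {Suc r..<k}) = ?P \<union> (tri k \<union> row k)"
      by auto
    also have "tri k \<union> row k = (\<Union>j\<in>{c..<d}. {{w,k,r,j,Suc j}, {w,k,Suc k,j,Suc j}})"
    proof -
      have "{w,k,r,j,Suc j} = {w,r,k,j,Suc j}" for j by auto
      then show ?thesis unfolding tri_def row_def UN_doubleton by (simp only:)
    qed
    finally have S': "facet_sphere 4 (?P \<union> (\<Union>j\<in>{c..<d}. {{w,k,r,j,Suc j}, {w,k,Suc k,j,Suc j}}))"
      using step by simp
    \<comment> \<open>In the quadrilateral \<open>w, r, k, Suc k\<close> the diagonal
      \<open>{w, k}\<close> is exchanged for \<open>{r, Suc k}\<close>.\<close>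
    have "facet_sphere 4 (?P \<union> (\<Union>j\<in>{c..<d}. {{w,r,Suc k,j,Suc j}, {k,r,Suc k,j,Suc j}}) \<union>
        {{w,k,r,Suc k,c}, {w,k,r,Suc k,d}})"
    proof (rule path_flip[OF S'])
      show "c < d" "distinct [w, k, r, Suc k]" "{w, k, r, Suc k} \<inter> {c..d} = {}" using ord k by auto
      \<comment> \<open>Rows and fans are ruled out by their vertices off the path. Walls meet the
        path only in one of its ends, so they contain neither an edge nor an inner vertex of
        it.\<close>
      have cases: "\<sigma> \<in> P \<or> k \<notin> \<sigma> \<and> r \<notin> \<sigma> \<or> w \<notin> \<sigma> \<and> Suc k \<notin> \<sigma> \<or>
        (\<exists>i. r < i \<and> i < k \<and> (\<sigma> = {w,r,i,Suc i,c} \<or> \<sigma> = {w,r,i,Suc i,d}))" if "\<sigma> \<in> ?P" for \<sigma>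
      proof -
        consider "\<sigma> \<in> P" | "\<sigma> \<in> \<Union>(row ` {Suc k..<e})" | "\<sigma> \<in> \<Union>(fan ` {Suc r..<k})"
          | "\<sigma> \<in> \<Union>(wall ` {Suc r..<k})"
          using \<open>\<sigma> \<in> ?P\<close> by blast
        then show ?thesis
        proof cases
          case 2
          then obtain i j where "Suc k \<le> i" "c \<le> j" "j < d" "\<sigma> = {w,i,Suc i,j,Suc j}"
            unfolding row_def by auto
          then have "k \<notin> \<sigma> \<and> r \<notin> \<sigma>" using k ord by simp
          then show ?thesis by simp
        next
          case 3
          then obtain i j where "Suc r \<le> i" "i < k" "c \<le> j" "j < d" "\<sigma> = {r,i,Suc i,j,Suc j}"
            unfolding fan_def by auto
          then have "w \<notin> \<sigma> \<and> Suc k \<notin> \<sigma>" using k ord by simp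
          then show ?thesis by simp
        next
          case 4
          then obtain i where "i \<in> {Suc r..<k}" "\<sigma> \<in> wall i" by (elim UN_E)
          then have "r < i \<and> i < k \<and> (\<sigma> = {w,r,i,Suc i,c} \<or> \<sigma> = {w,r,i,Suc i,d})"
            unfolding wall_def by simp
          then show ?thesis by (intro disjI2 exI)
        qed simp
      qed
      show "\<not> {w, k, j, Suc j} \<subseteq> \<sigma>" if "\<sigma> \<in> ?P" "c \<le> j" "j < d" for \<sigma> j
      proof -
        have "\<not> {j, Suc j} \<subseteq> \<sigma>" if "r < i" "i < k" "\<sigma> = {w,r,i,Suc i,c} \<or> \<sigma> = {w,r,i,Suc i,d}" for i
          using that \<open>c \<le> j\<close> \<open>j < d\<close> ord k by auto
        then show ?thesis using cases[OF \<open>\<sigma> \<in> ?P\<close>] nA[of \<sigma> k j] \<open>c \<le> j\<close> \<open>j < d\<close> k by blast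
      qed
      show "\<not> {w, k, j} \<subseteq> \<sigma>" if "\<sigma> \<in> ?P" "c < j" "j < d" for \<sigma> j
      proof -
        have "j \<notin> \<sigma>" if "r < i" "i < k" "\<sigma> = {w,r,i,Suc i,c} \<or> \<sigma> = {w,r,i,Suc i,d}" for i
          using that \<open>c < j\<close> \<open>j < d\<close> ord k by auto
        then show ?thesis using cases[OF \<open>\<sigma> \<in> ?P\<close>] nA'[of \<sigma> k j] \<open>c < j\<close> \<open>j < d\<close> k by blast
      qed
      show "\<not> {r, Suc k} \<subseteq> \<sigma>" if "\<sigma> \<in> ?P" for \<sigma>
      proof -
        have w: "Suc k \<notin> \<sigma>" if "\<exists>i. r < i \<and> i < k \<and> (\<sigma> = {w,r,i,Suc i,c} \<or> \<sigma> = {w,r,i,Suc i,d})"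
          using that ord k by (elim exE conjE disjE) simp_all
        have "\<not> {r, Suc k} \<subseteq> \<sigma>" if "\<sigma> \<in> P" using nB[OF that, of "Suc k"] k by simp
        then show ?thesis using cases[OF \<open>\<sigma> \<in> ?P\<close>] w by (elim disjE) simp_all
      qed
    qed
    also have "(\<Union>j\<in>{c..<d}. {{w,r,Suc k,j,Suc j}, {k,r,Suc k,j,Suc j}}) = tri (Suc k) \<union> fan k"
    proof -
      have "{k,r,Suc k,j,Suc j} = {r,k,Suc k,j,Suc j}" for j by auto
      then show ?thesis unfolding tri_def fan_def UN_doubleton by (simp only:)
    qed
    also have "{{w,k,r,Suc k,c}, {w,k,r,Suc k,d}} = wall k"
      unfolding wall_def by (simp only: insert_commute[of k r])
    also have "?P \<union> (tri (Suc k) \<union> fan k) \<union> wall k = P \<union> \<Union>(row ` {Suc k..<e}) \<union> tri (Suc k) \<union>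
       \<Union>(fan ` {Suc r..<Suc k}) \<union> \<Union>(wall ` {Suc r..<Suc k})"
    proof -
      have "{Suc r..<Suc k} = insert k {Suc r..<k}" using k by auto
      then show ?thesis by auto
    qed
    finally show ?case .
  qed
  from this[of e] ord show ?thesis unfolding row_def tri_def fan_def wall_def by simp
qed

section \<open>Subdividing the star of a face\<close>

lemma stellar_star:
  assumes nP: "\<And>\<sigma>. \<sigma> \<in> P \<Longrightarrow> \<not> A \<subseteq> \<sigma>" and L: "\<And>l. l \<in> L \<Longrightarrow> l \<inter> A = {}"
  shows "stellar A v (P \<union> (\<lambda>l. A \<union> l) ` L) = P \<union> (\<Union>l\<in>L. (\<lambda>f. insert v (A - {f}) \<union> l) ` A)"
proof -
  let ?F = "P \<union> (\<lambda>l. A \<union> l) ` L"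
  have 1: "{\<sigma> \<in> ?F. \<not> A \<subseteq> \<sigma>} = P" using nP by auto
  have e: "insert v (A \<union> l - {f}) = insert v (A - {f}) \<union> l" if "l \<in> L" "f \<in> A" for l f
    using L[OF that(1)] that by auto
  have 2: "{insert v (\<sigma> - {f}) |\<sigma> f. \<sigma> \<in> ?F \<and> A \<subseteq> \<sigma> \<and> f \<in> A} = (\<Union>l\<in>L. (\<lambda>f. insert v (A - {f}) \<union> l) ` A)"
  proof (intro set_eqI iffI)
    fix \<tau> assume "\<tau> \<in> {insert v (\<sigma> - {f}) |\<sigma> f. \<sigma> \<in> ?F \<and> A \<subseteq> \<sigma> \<and> f \<in> A}"
    then obtain \<sigma> f where s: "\<tau> = insert v (\<sigma> - {f})" "\<sigma> \<in> ?F" "A \<subseteq> \<sigma>" "f \<in> A" by blast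
    then have "\<sigma> \<notin> P" using nP by blast
    then obtain l where l: "l \<in> L" "\<sigma> = A \<union> l" using s(2) by blast
    then have "\<tau> = insert v (A - {f}) \<union> l" using s e by simp
    then show "\<tau> \<in> (\<Union>l\<in>L. (\<lambda>f. insert v (A - {f}) \<union> l) ` A)" using l(1) s(4) by (intro UN_I[OF l(1)] image_eqI[of _ _ f])
  next
    fix \<tau> assume "\<tau> \<in> (\<Union>l\<in>L. (\<lambda>f. insert v (A - {f}) \<union> l) ` A)"
    then obtain l f where l: "l \<in> L" "f \<in> A" "\<tau> = insert v (A - {f}) \<union> l" by (elim UN_E imageE)
    then have "\<tau> = insert v (A \<union> l - {f})" "A \<union> l \<in> ?F" "A \<subseteq> A \<union> l" using e by auto
    then show "\<tau> \<in> {insert v (\<sigma> - {f}) |\<sigma> f. \<sigma> \<in> ?F \<and> A \<subseteq> \<sigma> \<and> f \<in> A}"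
      using l(2) by (intro CollectI exI conjI)
  qed
  show ?thesis unfolding stellar_def 1 2 by (rule refl)
qed

text \<open>Stellar subdivision of the last edge \<open>{k, x}\<close> at \<open>Suc k\<close> keeps
  the link \<open>L\<close> for both halves. Repeating it produces the new vertices in the order of
  the path.\<close>

lemma subdivide_edge:
  fixes P :: "nat set set"
  assumes S: "facet_sphere 4 (P \<union> (\<lambda>l. {y,x} \<union> l) ` L)" and yx: "y < x"
    and nP: "\<And>\<sigma>. \<sigma> \<in> P \<Longrightarrow> \<not> {y,x} \<subseteq> \<sigma>" and nL: "\<And>l. l \<in> L \<Longrightarrow> l \<inter> {y..x} = {}"
    and fresh: "\<Union>P \<inter> {Suc y..<x} = {}"
  shows "facet_sphere 4 (P \<union> (\<Union>i\<in>{y..<x}. (\<lambda>l. {i,Suc i} \<union> l) ` L))"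
proof -
  let ?M = "\<lambda>k. \<Union>i\<in>{y..<k}. (\<lambda>l. {i,Suc i} \<union> l) ` L"
  have "facet_sphere 4 (P \<union> ?M k \<union> (\<lambda>l. {k,x} \<union> l) ` L)" if "y \<le> k" "k < x" for k
    using that
  proof (induction k rule: dec_induct)
    case base then show ?case using S by simp
  next
    case (step k)
    let ?F = "P \<union> ?M k \<union> (\<lambda>l. {k,x} \<union> l) ` L"
    have IH: "facet_sphere 4 ?F" using step by simp
    have k: "y \<le> k" "Suc k < x" using step by auto
    have n1: "\<not> {k,x} \<subseteq> \<sigma>" if \<sigma>: "\<sigma> \<in> P \<union> ?M k" for \<sigma>
    proof (cases "\<sigma> \<in> P")
      case True
      then have "k = y \<or> k \<notin> \<sigma>" using fresh k by fastforce
      then show ?thesis using nP True by blast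
    next
      case False
      then obtain i l where "y \<le> i" "i < k" "l \<in> L" "\<sigma> = {i,Suc i} \<union> l" using \<sigma> by auto
      moreover have "x \<notin> l" using nL[OF \<open>l \<in> L\<close>] yx by auto
      ultimately have "x \<notin> \<sigma>" using k by auto
      then show ?thesis by blast
    qed
    have v: "Suc k \<notin> \<Union>?F"
    proof -
      have "Suc k \<notin> \<Union>P" using fresh k by auto
      moreover have "Suc k \<notin> l" if "l \<in> L" for l using nL[OF that] k by auto
      ultimately show ?thesis using k by auto
    qed
    have "facet_sphere 4 (stellar {k,x} (Suc k) ?F)"
      by (rule facet_sphere_stellar[OF IH]) (use v k in auto)
    also have "stellar {k,x} (Suc k) ?F = P \<union> ?M (Suc k) \<union> (\<lambda>l. {Suc k,x} \<union> l) ` L"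
    proof -
      have "l \<inter> {k,x} = {}" if "l \<in> L" for l using nL[OF that] k yx by auto
      then have "stellar {k,x} (Suc k) ?F = P \<union> ?M k \<union> (\<Union>l\<in>L. (\<lambda>f. insert (Suc k) ({k,x} - {f}) \<union> l) ` {k,x})"
        by (intro stellar_star n1) auto
      also have "\<dots> = P \<union> ?M k \<union> (\<lambda>l. {k,Suc k} \<union> l) ` L \<union> (\<lambda>l. {Suc k,x} \<union> l) ` L"
      proof -
        have "insert (Suc k) ({k,x} - {k}) = {Suc k,x}" "insert (Suc k) ({k,x} - {x}) = {k,Suc k}" using k by auto
        then show ?thesis by (simp only: UN_doubleton image_insert image_empty Un_ac)
      qed
      finally have "stellar {k,x} (Suc k) ?F = P \<union> ?M k \<union> (\<lambda>l. {k,Suc k} \<union> l) ` L \<union> (\<lambda>l. {Suc k,x} \<union> l) ` L" .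
      moreover have "{y..<Suc k} = insert k {y..<k}" using k by auto
      ultimately show ?thesis by (simp add: Un_ac)
    qed
    finally show ?case .
  qed
  from this[of "x - 1"] yx
  have "facet_sphere 4 (P \<union> ?M (x - 1) \<union> (\<lambda>l. {x - 1,x} \<union> l) ` L)" by simp
  moreover have "{y..<x} = insert (x - 1) {y..<x - 1}" using yx by auto
  ultimately show ?thesis using yx by (simp add: Un_ac)
qed

section \<open>Appending vertices to a path\<close>

definition joins :: "'a set \<Rightarrow> 'a set set \<Rightarrow> 'a set set" where
  "joins Z C = {insert z \<epsilon> | z \<epsilon>. z \<in> Z \<and> \<epsilon> \<in> C}"

lemma joins_Un: "joins Z (C \<union> D) = joins Z C \<union> joins Z D"
  by (auto simp: joins_def)

lemma joins_insert: "joins Z (insert e D) = (\<lambda>z. insert z e) ` Z \<union> joins Z D"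
  by (auto simp: joins_def)

text \<open>Here \<open>y\<close> is the last vertex of a path whose other vertices form the circle \<open>C\<close>, closed up by the
  edge \<open>{a, b}\<close> between the predecessor \<open>a\<close> of \<open>y\<close> and the first vertex \<open>b\<close>; \<open>Z\<close> is the pair of suspension
  points. The edge \<open>{u, y}\<close> is subdivided by \<open>x\<close>, and flipping \<open>{a, x, b}\<close> to \<open>{u, y}\<close> puts \<open>y\<close> into the
  circle around \<open>{u, x}\<close>, so that the path can be continued. These are the insertion steps for cyclic
  4-polytopes, suspended.\<close>

lemma append_vertex:
  fixes F :: "nat set set"
  assumes S: "facet_sphere 4 F" and Z: "finite Z"
    and star: "{\<sigma> \<in> F. {u,y} \<subseteq> \<sigma>} = (\<lambda>l. {u,y} \<union> l) ` joins Z C"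
    and C: "\<And>\<epsilon>. \<epsilon> \<in> C \<Longrightarrow> card \<epsilon> = 2" "\<And>\<epsilon>. \<epsilon> \<in> C \<Longrightarrow> \<epsilon> \<inter> insert u (insert y Z) = {}"
    and ab: "{a,b} \<in> C" and uy: "u \<noteq> y" "u \<notin> Z" "y \<notin> Z"
    and x: "x \<notin> \<Union>F" "x \<notin> insert u (insert y Z)" "x \<notin> \<Union>C"
  obtains F' where "facet_sphere 4 F'"
    "{\<sigma> \<in> F'. {u,x} \<subseteq> \<sigma>} = (\<lambda>l. {u,x} \<union> l) ` joins Z (C - {{a,b}} \<union> {{a,y},{b,y}})"
    "{\<sigma> \<in> F'. x \<in> \<sigma> \<and> u \<notin> \<sigma>} = (\<lambda>l. {x,y} \<union> l) ` joins Z (C - {{a,b}})"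
    "{\<sigma> \<in> F'. x \<notin> \<sigma>} = {\<sigma> \<in> F. \<not> {u,y} \<subseteq> \<sigma>} \<union> (\<lambda>z. {a,b,y,u,z}) ` Z"
    "\<Union>F' \<subseteq> insert x (\<Union>F)"
proof -
  define P where "P = {\<sigma> \<in> F. \<not> {u,y} \<subseteq> \<sigma>}"
  define L where "L = joins Z (C - {{a,b}})"
  have ab': "a \<noteq> b" "a \<notin> insert u (insert y Z)" "b \<notin> insert u (insert y Z)" "x \<noteq> a" "x \<noteq> b"
    using C[OF ab] ab x(3) by (auto simp: card_insert_if split: if_splits)
  have L0: "joins Z C = L \<union> (\<lambda>z. {z,a,b}) ` Z"
    using ab joins_insert[of Z "{a,b}" "C - {{a,b}}"] insert_absorb[OF ab] unfolding L_def by (simp add: Un_commute)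
  have Ld: "u \<notin> l" "y \<notin> l" "x \<notin> l" if "l \<in> L" for l
    using that C(2) uy x unfolding L_def joins_def by blast+
  \<comment> \<open>No other face of the link contains both \<open>a\<close> and \<open>b\<close>,
    since \<open>C\<close> consists of 2-sets. Hence after the subdivision only the facets over the
    closing edge contain \<open>{a, x, b}\<close>, as the flip requires.\<close>
  have Lab: "\<not> {a,b} \<subseteq> l" if lL: "l \<in> L" for l
  proof
    assume s: "{a,b} \<subseteq> l"
    obtain z \<epsilon> where l: "z \<in> Z" "\<epsilon> \<in> C" "\<epsilon> \<noteq> {a,b}" "l = insert z \<epsilon>"
      using lL unfolding L_def joins_def by blast
    then have "{a,b} \<subseteq> \<epsilon>" using s ab' by auto
    moreover have "card \<epsilon> = card {a,b}" "finite \<epsilon>" using C(1)[OF l(2)] ab' by (auto intro: card_ge_0_finite)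
    ultimately show False using l(3) by (metis card_subset_eq)
  qed
  have Pab: "x \<notin> \<sigma>" if "\<sigma> \<in> P" for \<sigma> using that x unfolding P_def by blast
  have "F = P \<union> (\<lambda>l. {u,y} \<union> l) ` joins Z C"
    using star unfolding P_def by blast
  moreover have "stellar {u,y} x (P \<union> (\<lambda>l. {u,y} \<union> l) ` joins Z C) =
     P \<union> (\<Union>l\<in>joins Z C. (\<lambda>f. insert x ({u,y} - {f}) \<union> l) ` {u,y})"
  proof (rule stellar_star)
    show "l \<inter> {u,y} = {}" if "l \<in> joins Z C" for l
      using that C(2) uy unfolding joins_def by blast
  qed (auto simp: P_def)
  ultimately have "stellar {u,y} x F = P \<union> (\<Union>l\<in>joins Z C. (\<lambda>f. insert x ({u,y} - {f}) \<union> l) ` {u,y})"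
    by simp
  also have "\<dots> = P \<union> ((\<lambda>l. {x,y} \<union> l) ` joins Z C \<union> (\<lambda>l. {x,u} \<union> l) ` joins Z C)"
  proof -
    have "insert x ({u,y} - {u}) = {x,y}" "insert x ({u,y} - {y}) = {x,u}" using uy by auto
    then show ?thesis by (simp only: UN_doubleton image_insert image_empty)
  qed
  also have "\<dots> = (P \<union> (\<lambda>l. {x,y} \<union> l) ` L \<union> (\<lambda>l. {x,u} \<union> l) ` L) \<union>
      (\<Union>l\<in>(\<lambda>z. {z}) ` Z. (\<lambda>g. {a,x,b} \<union> ({y,u} - {g}) \<union> l) ` {y,u})" (is "_ = ?P \<union> _")
  proof -
    have "{a,x,b} \<union> ({y,u} - {y}) \<union> {z} = {x,u} \<union> {z,a,b}" "{a,x,b} \<union> ({y,u} - {u}) \<union> {z} = {x,y} \<union> {z,a,b}" for z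
      using uy by auto
    then show ?thesis unfolding L0
      by (simp only: UN_doubleton image_insert image_empty image_Un image_image UN_simps Un_ac)
  qed
  finally have st: "stellar {u,y} x F = ?P \<union> (\<Union>l\<in>(\<lambda>z. {z}) ` Z. (\<lambda>g. {a,x,b} \<union> ({y,u} - {g}) \<union> l) ` {y,u})" .
  have "facet_sphere 4 (stellar {u,y} x F)"
    by (rule facet_sphere_stellar[OF S]) (use x in auto)
  \<comment> \<open>This is the 2-3 flip of dimension 3, joined with the points of \<open>Z\<close>,
    which enter \<open>facet_sphere_flip\<close> as singleton faces.\<close>
  then have S': "facet_sphere 4 (?P \<union> (\<Union>l\<in>(\<lambda>z. {z}) ` Z. (\<lambda>f. ({a,x,b} - {f}) \<union> {y,u} \<union> l) ` {a,x,b}))"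
    unfolding st
  proof (rule facet_sphere_flip)
    show "{a,x,b} \<inter> {y,u} = {}" using ab' x by auto
    show "l \<inter> ({a,x,b} \<union> {y,u}) = {}" if "l \<in> (\<lambda>z. {z}) ` Z" for l
      using that ab' x uy by auto
    show "\<not> {a,x,b} \<subseteq> \<sigma>" if "\<sigma> \<in> ?P" for \<sigma>
      using that
    proof (elim UnE imageE)
      assume "\<sigma> \<in> P" then show ?thesis using Pab by blast
    next
      fix l assume "l \<in> L" "\<sigma> = {x,y} \<union> l" then show ?thesis using Lab[of l] ab' by auto
    next
      fix l assume "l \<in> L" "\<sigma> = {x,u} \<union> l" then show ?thesis using Lab[of l] ab' by auto
    qed
    show "\<not> {y,u} \<subseteq> \<sigma>" if "\<sigma> \<in> ?P" for \<sigma>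
      using that
    proof (elim UnE imageE)
      assume "\<sigma> \<in> P" then show ?thesis by (auto simp: P_def)
    next
      fix l assume "l \<in> L" "\<sigma> = {x,y} \<union> l" then show ?thesis using Ld[of l] uy x by auto
    next
      fix l assume "l \<in> L" "\<sigma> = {x,u} \<union> l" then show ?thesis using Ld[of l] uy x by auto
    qed
  qed (use Z in auto)
  \<comment> \<open>\<open>Q\<close> consists of the facets over the two new circle edges at
    \<open>y\<close>, and \<open>R\<close> of facets without \<open>x\<close>, which cut the old
    closing edge \<open>{a, b}\<close> off from \<open>x\<close>.\<close>
  define Q where "Q = (\<lambda>z. {u,x} \<union> {z,a,y}) ` Z \<union> (\<lambda>z. {u,x} \<union> {z,b,y}) ` Z"
  define R where "R = (\<lambda>z. {a,b,y,u,z}) ` Z"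
  define F' where "F' = P \<union> (\<lambda>l. {x,y} \<union> l) ` L \<union> (\<lambda>l. {u,x} \<union> l) ` L \<union> Q \<union> R"
  have "?P \<union> (\<Union>l\<in>(\<lambda>z. {z}) ` Z. (\<lambda>f. ({a,x,b} - {f}) \<union> {y,u} \<union> l) ` {a,x,b}) = F'"
  proof -
    have "({a,x,b} - {a}) \<union> {y,u} \<union> {z} = {u,x} \<union> {z,b,y}" "({a,x,b} - {x}) \<union> {y,u} \<union> {z} = {a,b,y,u,z}"
      "({a,x,b} - {b}) \<union> {y,u} \<union> {z} = {u,x} \<union> {z,a,y}" for z
      using ab' by auto
    moreover have "(\<Union>z\<in>Z. {f z, g z, h z}) = f ` Z \<union> g ` Z \<union> h ` Z" for f g h :: "nat \<Rightarrow> nat set" by auto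
    ultimately have "(\<Union>l\<in>(\<lambda>z. {z}) ` Z. (\<lambda>f. ({a,x,b} - {f}) \<union> {y,u} \<union> l) ` {a,x,b}) = 
      (\<lambda>z. {u,x} \<union> {z,b,y}) ` Z \<union> R \<union> (\<lambda>z. {u,x} \<union> {z,a,y}) ` Z"
      unfolding R_def by (simp only: image_insert image_empty UN_simps)
    moreover have "P \<union> A \<union> B \<union> W = P \<union> A \<union> B \<union> (X \<union> Y) \<union> R" if "W = Y \<union> R \<union> X" for A B W X Y
      unfolding that by blast
    moreover have "{x,u} = {u,x}" by auto
    ultimately show ?thesis unfolding F'_def Q_def by metis
  qed
  then have "facet_sphere 4 F'" using S' by simp
  moreover have "{\<sigma> \<in> F'. {u,x} \<subseteq> \<sigma>} = (\<lambda>l. {u,x} \<union> l) ` joins Z (C - {{a,b}} \<union> {{a,y},{b,y}})"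
  proof -
    have "(\<lambda>l. {u,x} \<union> l) ` joins Z (C - {{a,b}} \<union> {{a,y},{b,y}}) = (\<lambda>l. {u,x} \<union> l) ` L \<union> Q"
    proof -
      have "joins Z {} = {}" by (simp add: joins_def)
      then show ?thesis unfolding joins_Un joins_insert Q_def L_def[symmetric] image_Un image_image by (simp only: image_empty Un_empty_right)
    qed
    moreover have "{\<sigma> \<in> F'. {u,x} \<subseteq> \<sigma>} = (\<lambda>l. {u,x} \<union> l) ` L \<union> Q"
    proof (intro set_eqI iffI)
      fix \<sigma> assume "\<sigma> \<in> {\<sigma> \<in> F'. {u,x} \<subseteq> \<sigma>}"
      then have s: "\<sigma> \<in> F'" "u \<in> \<sigma>" "x \<in> \<sigma>" by auto
      have "\<sigma> \<notin> P" using s Pab by auto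
      moreover have "\<sigma> \<notin> (\<lambda>l. {x,y} \<union> l) ` L" using s Ld uy x by auto
      moreover have "\<sigma> \<notin> R" using s ab' x by (auto simp: R_def)
      ultimately show "\<sigma> \<in> (\<lambda>l. {u,x} \<union> l) ` L \<union> Q" using s(1) unfolding F'_def Un_iff by meson
    next
      fix \<sigma> assume s: "\<sigma> \<in> (\<lambda>l. {u,x} \<union> l) ` L \<union> Q"
      then have "{u,x} \<subseteq> \<sigma>" unfolding Q_def by auto
      then show "\<sigma> \<in> {\<sigma> \<in> F'. {u,x} \<subseteq> \<sigma>}" using s unfolding F'_def Un_iff mem_Collect_eq by meson
    qed
    ultimately show ?thesis by simp
  qed
  moreover have "{\<sigma> \<in> F'. x \<in> \<sigma> \<and> u \<notin> \<sigma>} = (\<lambda>l. {x,y} \<union> l) ` joins Z (C - {{a,b}})"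
    unfolding L_def[symmetric]
  proof (intro set_eqI iffI)
    fix \<sigma> assume "\<sigma> \<in> {\<sigma> \<in> F'. x \<in> \<sigma> \<and> u \<notin> \<sigma>}"
    then have s: "\<sigma> \<in> F'" "u \<notin> \<sigma>" "x \<in> \<sigma>" by auto
    have "\<sigma> \<notin> P" using s Pab by auto
    moreover have "\<sigma> \<notin> (\<lambda>l. {u,x} \<union> l) ` L \<union> Q \<union> R" using s by (auto simp: R_def Q_def)
    ultimately show "\<sigma> \<in> (\<lambda>l. {x,y} \<union> l) ` L" using s(1) unfolding F'_def Un_iff by meson
  next
    fix \<sigma> assume s: "\<sigma> \<in> (\<lambda>l. {x,y} \<union> l) ` L"
    then have "x \<in> \<sigma>" "u \<notin> \<sigma>" using Ld uy x by auto
    then show "\<sigma> \<in> {\<sigma> \<in> F'. x \<in> \<sigma> \<and> u \<notin> \<sigma>}" using s unfolding F'_def Un_iff mem_Collect_eq by meson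
  qed
  moreover have "{\<sigma> \<in> F'. x \<notin> \<sigma>} = {\<sigma> \<in> F. \<not> {u,y} \<subseteq> \<sigma>} \<union> (\<lambda>z. {a,b,y,u,z}) ` Z"
    unfolding P_def[symmetric] R_def[symmetric]
  proof (intro set_eqI iffI)
    fix \<sigma> assume "\<sigma> \<in> {\<sigma> \<in> F'. x \<notin> \<sigma>}"
    then have s: "\<sigma> \<in> F'" "x \<notin> \<sigma>" by auto
    have "\<sigma> \<notin> (\<lambda>l. {x,y} \<union> l) ` L \<union> (\<lambda>l. {u,x} \<union> l) ` L \<union> Q" using s(2) by (auto simp: Q_def)
    then show "\<sigma> \<in> P \<union> R" using s(1) unfolding F'_def Un_iff by meson
  next
    fix \<sigma> assume s: "\<sigma> \<in> P \<union> R"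
    then have "x \<notin> \<sigma>" using Pab ab' x by (auto simp: R_def)
    then show "\<sigma> \<in> {\<sigma> \<in> F'. x \<notin> \<sigma>}" using s unfolding F'_def Un_iff mem_Collect_eq by meson
  qed
  moreover have "\<Union>F' \<subseteq> insert x (\<Union>F)"
  proof -
    have l: "u \<in> \<Union>F" "y \<in> \<Union>F" "l \<subseteq> \<Union>F" if "l \<in> joins Z C" for l
    proof -
      have "{u,y} \<union> l \<in> {\<sigma> \<in> F. {u,y} \<subseteq> \<sigma>}" unfolding star using that by (rule imageI)
      then have "{u,y} \<union> l \<in> F" by simp
      then have "{u,y} \<union> l \<subseteq> \<Union>F" by (rule Union_upper)
      then show "u \<in> \<Union>F" "y \<in> \<Union>F" "l \<subseteq> \<Union>F" by blast+
    qed
    have 1: "\<Union>P \<subseteq> \<Union>F" unfolding P_def by blast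
    have 2: "{x,y} \<union> l \<subseteq> insert x (\<Union>F)" "{u,x} \<union> l \<subseteq> insert x (\<Union>F)" if "l \<in> L" for l
    proof -
      have "l \<in> joins Z C" using that L0 by simp
      from l[OF this] show "{x,y} \<union> l \<subseteq> insert x (\<Union>F)" "{u,x} \<union> l \<subseteq> insert x (\<Union>F)" by blast+
    qed
    have 3: "{u,x} \<union> {z,a,y} \<subseteq> insert x (\<Union>F)" "{u,x} \<union> {z,b,y} \<subseteq> insert x (\<Union>F)" "{a,b,y,u,z} \<subseteq> insert x (\<Union>F)"
      if "z \<in> Z" for z
    proof -
      have "{z,a,b} \<in> joins Z C" using that L0 by simp
      from l[OF this] show "{u,x} \<union> {z,a,y} \<subseteq> insert x (\<Union>F)" "{u,x} \<union> {z,b,y} \<subseteq> insert x (\<Union>F)" "{a,b,y,u,z} \<subseteq> insert x (\<Union>F)"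
        by blast+
    qed
    have "\<sigma> \<subseteq> insert x (\<Union>F)" if "\<sigma> \<in> F'" for \<sigma>
      using that unfolding F'_def Q_def R_def
    proof (elim UnE imageE)
      assume "\<sigma> \<in> P" then show ?thesis using 1 by blast
    qed (simp_all only: 2 3)
    then show ?thesis by blast
  qed
  ultimately show thesis by (rule that)
qed

section \<open>Spheres with a path and a marked edge\<close>

definition edges :: "nat \<Rightarrow> nat \<Rightarrow> nat set set" where
  "edges p q = (\<lambda>j. {j, Suc j}) ` {p..<q}"

text \<open>The path is \<open>5, \<dots>, N\<close>. The vertices 1 and 2 are suspension points, and the edge \<open>{0, N}\<close>
  is the place where the path is continued. Vertices 3 and 4 come from the initial cross-polytope.\<close>

definition good :: "nat set set \<Rightarrow> nat \<Rightarrow> bool" where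
  "good F N \<longleftrightarrow> facet_sphere 4 F \<and> 9 \<le> N \<and> \<Union>F \<subseteq> {..N} \<and>
     {\<sigma> \<in> F. {0,N} \<subseteq> \<sigma>} = (\<lambda>l. {0,N} \<union> l) ` joins {1,2} (edges 5 (N - 1) \<union> {{N - 1,5}})"

lemma edges_Suc: "p \<le> q \<Longrightarrow> edges p (Suc q) = edges p q \<union> {{q, Suc q}}"
  by (simp add: edges_def atLeastLessThanSuc)

lemma edges_append: "p \<le> q \<Longrightarrow> q \<le> r \<Longrightarrow> edges p r = edges p q \<union> edges q r"
  by (simp add: edges_def ivl_disj_un_two(3) flip: image_Un)

lemma edges_bounds:
  assumes "\<epsilon> \<in> edges p q"
  shows "\<epsilon> \<subseteq> {p..q}" "card \<epsilon> = 2"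
  using assms by (auto simp: edges_def)

text \<open>Two vertices \<open>x\<close> and \<open>x'\<close> are appended first, and only then is the edge \<open>{N, x}\<close> subdivided by the
  block. Hence no two non-consecutive block vertices are adjacent, which is what leaves room for the
  fans.\<close>

lemma insert_path:
  fixes F :: "nat set set" and N h :: nat
  assumes g: "good F N"
  defines "x \<equiv> N + h + 1" and "x' \<equiv> N + h + 2"
  obtains P L F' where "facet_sphere 4 F'" "\<Union>F' \<subseteq> {..x'}"
    "{\<sigma> \<in> F'. {0,x'} \<subseteq> \<sigma>} = (\<lambda>l. {0,x'} \<union> l) ` joins {1,2} (edges 5 x \<union> {{x,5}})"
    "{\<sigma> \<in> F. 0 \<notin> \<sigma>} \<subseteq> F'"
    "F' = P \<union> (\<Union>i\<in>{N..<x}. (\<lambda>l. {i,Suc i} \<union> l) ` L)"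
    "\<Union>P \<inter> {N<..<x} = {}"
    "L = joins {1,2} (edges 5 (N - 1) \<union> {{x',N - 1}, {5,0}, {x',0}})"
proof -
  define Z where "Z = {1,2::nat}"
  define a where "a = N - 1"
  define E where "E = edges 5 a"
  have N: "9 \<le> N" and S: "facet_sphere 4 F" and VF: "\<Union>F \<subseteq> {..N}"
    and st: "{\<sigma> \<in> F. {0,N} \<subseteq> \<sigma>} = (\<lambda>l. {0,N} \<union> l) ` joins Z (E \<union> {{a,5}})"
    using g by (auto simp: good_def Z_def E_def a_def)
  have a: "8 \<le> a" "Suc a = N" using N by (auto simp: a_def)
  have E: "\<epsilon> \<subseteq> {5..a}" "card \<epsilon> = 2" if "\<epsilon> \<in> E" for \<epsilon>
    using edges_bounds that by (auto simp: E_def)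
  have Em: "5 \<le> v \<and> v \<le> a" if "\<epsilon> \<in> E" "v \<in> \<epsilon>" for \<epsilon> v using E(1)[OF that(1)] that(2) by auto
  have nE: "{a,5} \<notin> E"
    using a by (auto simp: E_def edges_def doubleton_eq_iff)
  have Z: "finite Z" "Z \<subseteq> {1,2}" by (auto simp: Z_def)
  have c: "card \<epsilon> = 2" "\<epsilon> \<inter> insert 0 (insert N Z) = {}" if "\<epsilon> \<in> E \<union> {{a,5}}" for \<epsilon>
    using that E(2) a by (auto simp: Z_def dest: Em)
  have c': "{a,5} \<in> E \<union> {{a,5}}" "0 \<noteq> N" "0 \<notin> Z" "N \<notin> Z" "x \<notin> \<Union>F" "x \<notin> insert 0 (insert N Z)" "x \<notin> \<Union>(E \<union> {{a,5}})"
    using a VF by (auto simp: x_def Z_def dest: Em)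
  obtain F2 where F2: "facet_sphere 4 F2"
    and i: "{\<sigma> \<in> F2. {0,x} \<subseteq> \<sigma>} = (\<lambda>l. {0,x} \<union> l) ` joins Z (E \<union> {{a,5}} - {{a,5}} \<union> {{a,N},{5,N}})"
    and ii: "{\<sigma> \<in> F2. x \<in> \<sigma> \<and> 0 \<notin> \<sigma>} = (\<lambda>l. {x,N} \<union> l) ` joins Z (E \<union> {{a,5}} - {{a,5}})"
    and iii: "{\<sigma> \<in> F2. x \<notin> \<sigma>} = {\<sigma> \<in> F. \<not> {0,N} \<subseteq> \<sigma>} \<union> (\<lambda>z. {a,5,N,0,z}) ` Z"
    and V2: "\<Union>F2 \<subseteq> insert x (\<Union>F)"
    by (rule append_vertex[OF S Z(1) st c c'])
  have E': "E \<union> {{a,5}} - {{a,5}} = E" using nE by auto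
  define E2 where "E2 = edges 5 N"
  have E2: "E \<union> {{a,N},{5,N}} = E2 \<union> {{N,5}}"
    using edges_Suc[of 5 a] a by (simp add: E_def E2_def insert_commute)
  have E2b: "\<epsilon> \<subseteq> {5..N}" "card \<epsilon> = 2" if "\<epsilon> \<in> E2" for \<epsilon>
    using edges_bounds that by (auto simp: E2_def)
  have E2m: "5 \<le> v \<and> v \<le> N" if "\<epsilon> \<in> E2" "v \<in> \<epsilon>" for \<epsilon> v using E2b(1)[OF that(1)] that(2) by auto
  have nE2: "{N,5} \<notin> E2"
  proof
    assume "{N,5} \<in> E2"
    then obtain j where "{N,5} = {j, Suc j}" unfolding E2_def edges_def by (elim imageE)
    then show False using a unfolding doubleton_eq_iff by linarith
  qed
  have xx: "N < x" "x < x'" "x' = Suc x" by (auto simp: x_def x'_def)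
  note i = i[unfolded E' E2] and ii = ii[unfolded E']
  have c: "card \<epsilon> = 2" "\<epsilon> \<inter> insert 0 (insert x Z) = {}" if "\<epsilon> \<in> E2 \<union> {{N,5}}" for \<epsilon>
    using that E2b(2) a xx by (auto simp: Z_def dest: E2m)
  have V2x: "\<Union>F2 \<subseteq> {..x}" using V2 VF xx(1) by (meson atMost_iff insert_subset less_imp_le_nat order_refl subset_trans atMost_subset_iff)
  have x'F2: "x' \<notin> \<Union>F2" using V2x xx(2) by (meson atMost_iff not_le subsetD)
  have c': "{N,5} \<in> E2 \<union> {{N,5}}" "0 \<noteq> x" "0 \<notin> Z" "x \<notin> Z" "x' \<notin> \<Union>F2" "x' \<notin> insert 0 (insert x Z)" "x' \<notin> \<Union>(E2 \<union> {{N,5}})"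
    using a x'F2 xx by (auto simp: Z_def dest: E2m)
  obtain F3 where F3: "facet_sphere 4 F3"
    and j: "{\<sigma> \<in> F3. {0,x'} \<subseteq> \<sigma>} = (\<lambda>l. {0,x'} \<union> l) ` joins Z (E2 \<union> {{N,5}} - {{N,5}} \<union> {{N,x},{5,x}})"
    and jj: "{\<sigma> \<in> F3. x' \<in> \<sigma> \<and> 0 \<notin> \<sigma>} = (\<lambda>l. {x',x} \<union> l) ` joins Z (E2 \<union> {{N,5}} - {{N,5}})"
    and jjj: "{\<sigma> \<in> F3. x' \<notin> \<sigma>} = {\<sigma> \<in> F2. \<not> {0,x} \<subseteq> \<sigma>} \<union> (\<lambda>z. {N,5,x,0,z}) ` Z"
    and V3: "\<Union>F3 \<subseteq> insert x' (\<Union>F2)"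
    by (rule append_vertex[OF F2 Z(1) i c c'])
  have E2': "E2 \<union> {{N,5}} - {{N,5}} = E2" using nE2 by auto
  note j = j[unfolded E2'] and jj = jj[unfolded E2']
  have VF3: "\<Union>F3 \<subseteq> {..N} \<union> {x,x'}" using V2 V3 VF by blast
  \<comment> \<open>The link of \<open>{N, x}\<close> is the suspension of the circle through
    \<open>5, ..., a, x', 0\<close>. The edges in \<open>E\<close> stem from the first appending
    step, \<open>{x', a}\<close> and \<open>{x', 0}\<close> from the facets with \<open>x'\<close>,
    and \<open>{5, 0}\<close> from the facets without \<open>x'\<close> that the second flip
    creates.\<close>
  define L where "L = joins Z (E \<union> {{x',a}, {5,0}, {x',0}})"
  have star: "{\<sigma> \<in> F3. {N,x} \<subseteq> \<sigma>} = (\<lambda>l. {N,x} \<union> l) ` L"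
  proof (intro set_eqI iffI)
    fix \<sigma> assume "\<sigma> \<in> {\<sigma> \<in> F3. {N,x} \<subseteq> \<sigma>}"
    then have s: "\<sigma> \<in> F3" "N \<in> \<sigma>" "x \<in> \<sigma>" by auto
    consider "x' \<in> \<sigma>" "0 \<in> \<sigma>" | "x' \<in> \<sigma>" "0 \<notin> \<sigma>" | "x' \<notin> \<sigma>" by blast
    then show "\<sigma> \<in> (\<lambda>l. {N,x} \<union> l) ` L"
    proof cases
      case 1
      then have "\<sigma> \<in> (\<lambda>l. {0,x'} \<union> l) ` joins Z (E2 \<union> {{N,x},{5,x}})" using s j by blast
      then obtain z \<epsilon> where z: "z \<in> Z" "\<epsilon> \<in> E2 \<union> {{N,x},{5,x}}" "\<sigma> = {0,x'} \<union> insert z \<epsilon>"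
        unfolding joins_def by blast
      then have "x \<in> \<epsilon>" "N \<in> \<epsilon>" using s xx Z a by auto
      then have "\<epsilon> = {N,x}" using z xx a by (auto dest: E2m)
      then have "\<sigma> = {N,x} \<union> insert z {x',0}" using z by auto
      moreover have "insert z {x',0} \<in> L" using z unfolding L_def joins_def by blast
      ultimately show ?thesis by blast
    next
      case 2
      then have "\<sigma> \<in> (\<lambda>l. {x',x} \<union> l) ` joins Z E2" using s jj by blast
      then obtain z \<epsilon> where z: "z \<in> Z" "\<epsilon> \<in> E2" "\<sigma> = {x',x} \<union> insert z \<epsilon>"
        unfolding joins_def by blast
      then have "N \<in> \<epsilon>" using s xx Z a by auto
      then have "\<epsilon> = {a,N}" using z(2) a unfolding E2_def edges_def by auto
      then have "\<sigma> = {N,x} \<union> insert z {x',a}" using z by auto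
      moreover have "insert z {x',a} \<in> L" using z unfolding L_def joins_def by blast
      ultimately show ?thesis by blast
    next
      case 3
      then have "\<sigma> \<in> {\<sigma> \<in> F2. \<not> {0,x} \<subseteq> \<sigma>} \<union> (\<lambda>z. {N,5,x,0,z}) ` Z" using s jjj by blast
      then show ?thesis
      proof
        assume "\<sigma> \<in> {\<sigma> \<in> F2. \<not> {0,x} \<subseteq> \<sigma>}"
        then have "\<sigma> \<in> (\<lambda>l. {x,N} \<union> l) ` joins Z E" using s ii by blast
        then obtain l where "l \<in> joins Z E" "\<sigma> = {N,x} \<union> l" by auto
        then show ?thesis unfolding L_def joins_Un by blast
      next
        assume "\<sigma> \<in> (\<lambda>z. {N,5,x,0,z}) ` Z"
        then obtain z where z: "z \<in> Z" "\<sigma> = {N,x} \<union> insert z {5,0}" by auto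
        moreover have "insert z {5,0} \<in> L" using z unfolding L_def joins_def by blast
        ultimately show ?thesis by blast
      qed
    qed
  next
    fix \<sigma> assume "\<sigma> \<in> (\<lambda>l. {N,x} \<union> l) ` L"
    then obtain z \<epsilon> where z: "z \<in> Z" "\<epsilon> \<in> E \<union> {{x',a}, {5,0}, {x',0}}" "\<sigma> = {N,x} \<union> insert z \<epsilon>"
      unfolding L_def joins_def by blast
    then consider "\<epsilon> \<in> E" | "\<epsilon> = {x',a}" | "\<epsilon> = {5,0}" | "\<epsilon> = {x',0}" by blast
    then have "\<sigma> \<in> F3"
    proof cases
      case 1
      then have "insert z \<epsilon> \<in> joins Z E" using z unfolding joins_def by blast
      moreover have "\<sigma> = {x,N} \<union> insert z \<epsilon>" using z by auto
      ultimately have 2: "\<sigma> \<in> {\<sigma> \<in> F2. x \<in> \<sigma> \<and> 0 \<notin> \<sigma>}" unfolding ii by (rule image_eqI[rotated])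
      then have "\<sigma> \<in> F2" "\<not> {0,x} \<subseteq> \<sigma>" by auto
      then have "\<sigma> \<in> {\<sigma> \<in> F3. x' \<notin> \<sigma>}" unfolding jjj by simp
      then show ?thesis by blast
    next
      case 2
      have "{a,N} \<in> E2" using a unfolding E2_def edges_def by (auto intro!: image_eqI[of _ _ a])
      then have "insert z {a,N} \<in> joins Z E2" using z unfolding joins_def by blast
      moreover have "\<sigma> = {x',x} \<union> insert z {a,N}" using z 2 by auto
      ultimately have "\<sigma> \<in> {\<sigma> \<in> F3. x' \<in> \<sigma> \<and> 0 \<notin> \<sigma>}" unfolding jj by (rule image_eqI[rotated])
      then show ?thesis by blast
    next
      case 3
      have "\<sigma> = {N,5,x,0,z}" using z 3 by auto
      then have "\<sigma> \<in> {\<sigma> \<in> F3. x' \<notin> \<sigma>}" unfolding jjj using z(1) by blast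
      then show ?thesis by blast
    next
      case 4
      have "insert z {N,x} \<in> joins Z (E2 \<union> {{N,x},{5,x}})" using z unfolding joins_def by blast
      moreover have "\<sigma> = {0,x'} \<union> insert z {N,x}" using z 4 by auto
      ultimately have "\<sigma> \<in> {\<sigma> \<in> F3. {0,x'} \<subseteq> \<sigma>}" unfolding j by (rule image_eqI[rotated])
      then show ?thesis by blast
    qed
    then show "\<sigma> \<in> {\<sigma> \<in> F3. {N,x} \<subseteq> \<sigma>}" using z by blast
  qed
  define P where "P = {\<sigma> \<in> F3. \<not> {N,x} \<subseteq> \<sigma>}"
  have F3P: "F3 = P \<union> (\<lambda>l. {N,x} \<union> l) ` L" using star unfolding P_def by blast
  have Lb: "l \<inter> {N..x} = {}" "l \<subseteq> {..a} \<union> {x'}" if lL: "l \<in> L" for l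
  proof -
    obtain z \<epsilon> where z: "z \<in> Z" "\<epsilon> \<in> E \<union> {{x',a}, {5,0}, {x',0}}" "l = insert z \<epsilon>"
      using lL unfolding L_def joins_def by blast
    then have "\<epsilon> \<subseteq> {..a} \<union> {x'}" using z(2) a by (auto dest: Em)
    then show "l \<subseteq> {..a} \<union> {x'}" using z(1,3) a Z by auto
    then show "l \<inter> {N..x} = {}" using a xx by auto
  qed
  have PV: "\<Union>P \<inter> {N<..<x} = {}" using VF3 xx by (fastforce simp: P_def)
  \<comment> \<open>The edge \<open>{N, x}\<close> acquires the \<open>h\<close> inner vertices
    \<open>N + 1, ..., N + h\<close>. They form the block, and no face in \<open>P\<close> contains
    any of them.\<close>
  define F' where "F' = P \<union> (\<Union>i\<in>{N..<x}. (\<lambda>l. {i,Suc i} \<union> l) ` L)"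
  have "facet_sphere 4 F'"
    unfolding F'_def
  proof (rule subdivide_edge)
    show "facet_sphere 4 (P \<union> (\<lambda>l. {N,x} \<union> l) ` L)" using F3 F3P by simp
    show "\<Union>P \<inter> {Suc N..<x} = {}" using PV by auto
  qed (use xx Lb P_def in auto)
  moreover have "\<Union>F' \<subseteq> {..x'}"
  proof -
    have "\<Union>P \<subseteq> {..x'}" using VF3 xx by (force simp: P_def)
    moreover have "l \<subseteq> {..x'}" if "l \<in> L" for l
      using Lb(2)[OF that] a xx by auto
    ultimately have "\<sigma> \<subseteq> {..x'}" if "\<sigma> \<in> F'" for \<sigma>
      using that unfolding F'_def
    proof (elim UnE UN_E imageE)
      assume "\<sigma> \<in> P" then show ?thesis using \<open>\<Union>P \<subseteq> {..x'}\<close> by blast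
    qed (use xx in simp)
    then show ?thesis by blast
  qed
  moreover have "{\<sigma> \<in> F'. {0,x'} \<subseteq> \<sigma>} = (\<lambda>l. {0,x'} \<union> l) ` joins Z (edges 5 x \<union> {{x,5}})"
  proof -
    have ed: "edges 5 x = E2 \<union> edges N x" unfolding E2_def using edges_append[of 5 N x] a xx by simp
    show ?thesis
    proof (intro set_eqI iffI)
      fix \<sigma> assume s: "\<sigma> \<in> {\<sigma> \<in> F'. {0,x'} \<subseteq> \<sigma>}"
      then consider "\<sigma> \<in> P" | i l where "N \<le> i" "i < x" "l \<in> L" "\<sigma> = {i,Suc i} \<union> l"
        unfolding F'_def by auto
      then have "\<exists>z\<in>Z. \<exists>\<epsilon>\<in>edges 5 x \<union> {{x,5}}. \<sigma> = {0,x'} \<union> insert z \<epsilon>"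
      proof cases
        case 1
        then have "\<sigma> \<in> {\<sigma> \<in> F3. {0,x'} \<subseteq> \<sigma>}" using s unfolding P_def by blast
        then obtain z \<epsilon> where z: "z \<in> Z" "\<epsilon> \<in> E2 \<union> {{N,x},{5,x}}" "\<sigma> = {0,x'} \<union> insert z \<epsilon>"
          unfolding j joins_def by blast
        moreover have "\<epsilon> \<noteq> {N,x}" using z 1 unfolding P_def by auto
        ultimately show ?thesis using ed by blast
      next
        case (2 i l)
        obtain z \<epsilon> where z: "z \<in> Z" "\<epsilon> \<in> E \<union> {{x',a}, {5,0}, {x',0}}" "l = insert z \<epsilon>"
          using 2 unfolding L_def joins_def by blast
        have "0 \<in> \<epsilon>" "x' \<in> \<epsilon>" using s 2 z(1,3) xx a Z by auto
        then have "\<epsilon> = {x',0}" using z(2) a xx by (auto dest: Em)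
        then have "\<sigma> = {0,x'} \<union> insert z {i,Suc i}" using 2 z by auto
        moreover have "{i,Suc i} \<in> edges N x" using 2 unfolding edges_def by auto
        ultimately show ?thesis using z ed by blast
      qed
      then show "\<sigma> \<in> (\<lambda>l. {0,x'} \<union> l) ` joins Z (edges 5 x \<union> {{x,5}})"
        unfolding joins_def by blast
    next
      fix \<sigma> assume "\<sigma> \<in> (\<lambda>l. {0,x'} \<union> l) ` joins Z (edges 5 x \<union> {{x,5}})"
      then obtain z \<epsilon> where z: "z \<in> Z" "\<epsilon> \<in> edges 5 x \<union> {{x,5}}" "\<sigma> = {0,x'} \<union> insert z \<epsilon>"
        unfolding joins_def by blast
      then consider "\<epsilon> \<in> E2 \<union> {{5,x}}" | "\<epsilon> \<in> edges N x" unfolding ed by blast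
      then have "\<sigma> \<in> F'"
      proof cases
        case 1
        then have "insert z \<epsilon> \<in> joins Z (E2 \<union> {{N,x},{5,x}})" using z unfolding joins_def by blast
        then have "\<sigma> \<in> {\<sigma> \<in> F3. {0,x'} \<subseteq> \<sigma>}" unfolding j using z(3) by (rule image_eqI[rotated])
        moreover have "\<not> {N,x} \<subseteq> \<sigma>"
        proof -
          have "\<not> {N,x} \<subseteq> \<epsilon>" using 1 xx a by (auto dest: E2m)
          then show ?thesis using z(1,3) xx a Z by auto
        qed
        ultimately show ?thesis unfolding F'_def P_def by blast
      next
        case 2
        then obtain i where i: "N \<le> i" "i < x" "\<epsilon> = {i,Suc i}" unfolding edges_def by auto
        then have "\<sigma> = {i,Suc i} \<union> insert z {x',0}" using z by auto
        moreover have "insert z {x',0} \<in> L" using z unfolding L_def joins_def by blast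
        ultimately have "\<sigma> \<in> (\<lambda>l. {i,Suc i} \<union> l) ` L" by (rule image_eqI)
        then show ?thesis using i unfolding F'_def by (intro UnI2 UN_I[of i]) simp_all
      qed
      then show "\<sigma> \<in> {\<sigma> \<in> F'. {0,x'} \<subseteq> \<sigma>}" using z by blast
    qed
  qed
  \<comment> \<open>The two appending steps destroy only facets containing an edge at 0, and the
    last subdivision only facets containing the new vertex \<open>x\<close>.\<close>
  moreover have "{\<sigma> \<in> F. 0 \<notin> \<sigma>} \<subseteq> F'"
  proof
    fix \<sigma> assume "\<sigma> \<in> {\<sigma> \<in> F. 0 \<notin> \<sigma>}"
    then have s: "\<sigma> \<in> F" "0 \<notin> \<sigma>" by auto
    then have "x \<notin> \<sigma>" using VF xx by auto
    moreover have "\<sigma> \<in> {\<sigma> \<in> F2. x \<notin> \<sigma>}" unfolding iii using s by simp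
    moreover from this have "\<sigma> \<in> {\<sigma> \<in> F3. x' \<notin> \<sigma>}" unfolding jjj using s by simp
    ultimately show "\<sigma> \<in> F'" unfolding F'_def P_def by blast
  qed
  ultimately show thesis
    using that[of F' P L] PV F'_def L_def unfolding Z_def E_def a_def by blast
qed

section \<open>Blocks with fans\<close>

lemma block_step:
  fixes F :: "nat set set" and N h :: nat and c d :: "nat \<Rightarrow> nat"
  assumes g: "good F N"
    and slots: "\<And>s. s < h \<Longrightarrow> 5 \<le> c s \<and> c s < d s \<and> d s < N"
    and disj: "\<And>s t. s < h \<Longrightarrow> t < h \<Longrightarrow> s \<noteq> t \<Longrightarrow> {c s..d s} \<inter> {c t..d t} = {}"
  obtains F' where "good F' (N + h + 2)" "{\<sigma> \<in> F. 0 \<notin> \<sigma>} \<subseteq> F'"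
    "\<forall>s i j. s < h \<longrightarrow> N + Suc s < i \<longrightarrow> i < N + h \<longrightarrow> c s \<le> j \<longrightarrow> j < d s \<longrightarrow>
       {N + Suc s, i, Suc i, j, Suc j} \<in> F'"
proof -
  define x where "x = N + h + 1"
  define x' where "x' = N + h + 2"
  \<comment> \<open>The fans stop at the last block vertex and not at \<open>x\<close>, so that all
    vertices of the retriangulated discs other than 1 lie outside \<open>P\<close>.\<close>
  define e where "e = N + h"
  obtain P L F4 where S4: "facet_sphere 4 F4" and V4: "\<Union>F4 \<subseteq> {..x'}"
    and st4: "{\<sigma> \<in> F4. {0,x'} \<subseteq> \<sigma>} = (\<lambda>l. {0,x'} \<union> l) ` joins {1,2} (edges 5 x \<union> {{x,5}})"
    and keep4: "{\<sigma> \<in> F. 0 \<notin> \<sigma>} \<subseteq> F4"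
    and F4: "F4 = P \<union> (\<Union>i\<in>{N..<x}. (\<lambda>l. {i,Suc i} \<union> l) ` L)"
    and PV: "\<Union>P \<inter> {N<..<x} = {}"
    and L: "L = joins {1,2} (edges 5 (N - 1) \<union> {{x',N - 1}, {5,0}, {x',0}})"
    unfolding x_def x'_def by (rule insert_path[OF g])
  have N: "9 \<le> N" and VF: "\<Union>F \<subseteq> {..N}" using g by (auto simp: good_def)
  define old where "old s = (\<Union>i\<in>{N + Suc s..<e}. (\<lambda>j. {1,i,Suc i,j,Suc j}) ` {c s..<d s})" for s
  define new where "new s = (\<lambda>j. {1,N + Suc s,e,j,Suc j}) ` {c s..<d s} \<union>
    (\<Union>i\<in>{Suc (N + Suc s)..<e}. (\<lambda>j. {N + Suc s,i,Suc i,j,Suc j}) ` {c s..<d s}) \<union>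
    (\<Union>i\<in>{Suc (N + Suc s)..<e}. {{1,N + Suc s,i,Suc i,c s}, {1,N + Suc s,i,Suc i,d s}})" for s
  have oldE: "\<exists>i j. N + Suc s \<le> i \<and> i < e \<and> c s \<le> j \<and> j < d s \<and> \<sigma> = {1,i,Suc i,j,Suc j}" if "\<sigma> \<in> old s" for s \<sigma>
    using that unfolding old_def by (elim UN_E imageE) (metis atLeastLessThan_iff)
  have newE: "\<exists>B Q. \<sigma> = B \<union> Q \<and> Q \<subseteq> {c s..d s} \<and> (B = {1,N + Suc s,e} \<or>
      (\<exists>i. N + Suc s < i \<and> i < e \<and> (B = {N + Suc s,i,Suc i} \<or> B = {1,N + Suc s,i,Suc i})))" if ns: "\<sigma> \<in> new s" and sh: "s < h" for s \<sigma>
    using ns unfolding new_def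
  proof (elim UnE UN_E imageE)
    fix j assume "\<sigma> = {1,N + Suc s,e,j,Suc j}" "j \<in> {c s..<d s}"
    then have "\<sigma> = {1,N + Suc s,e} \<union> {j,Suc j}" "{j,Suc j} \<subseteq> {c s..d s}" by auto
    then show ?thesis by blast
  next
    fix i j assume i: "i \<in> {Suc (N + Suc s)..<e}" and "\<sigma> = {N + Suc s,i,Suc i,j,Suc j}" "j \<in> {c s..<d s}"
    then have "\<sigma> = {N + Suc s,i,Suc i} \<union> {j,Suc j}" "{j,Suc j} \<subseteq> {c s..d s}" by auto
    moreover have "N + Suc s < i \<and> i < e" using i by auto
    ultimately show ?thesis by blast
  next
    fix i assume i: "i \<in> {Suc (N + Suc s)..<e}" and "\<sigma> \<in> {{1,N + Suc s,i,Suc i,c s}, {1,N + Suc s,i,Suc i,d s}}"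
    then consider "\<sigma> = {1,N + Suc s,i,Suc i} \<union> {c s}" | "\<sigma> = {1,N + Suc s,i,Suc i} \<union> {d s}" by auto
    moreover have "N + Suc s < i \<and> i < e" using i by auto
    moreover have "{c s} \<subseteq> {c s..d s}" "{d s} \<subseteq> {c s..d s}" using slots[OF sh] by auto
    ultimately show ?thesis by (metis (no_types))
  qed
  have new_slot: "j \<notin> \<sigma>" if "\<sigma> \<in> new s" "s < h" "t < h" "s \<noteq> t" "j \<in> {c t..d t}" for \<sigma> s t j
  proof -
    note th = that
    obtain B Q where B: "\<sigma> = B \<union> Q" "Q \<subseteq> {c s..d s}" "B = {1,N + Suc s,e} \<or>
      (\<exists>i. N + Suc s < i \<and> i < e \<and> (B = {N + Suc s,i,Suc i} \<or> B = {1,N + Suc s,i,Suc i}))"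
      using newE[OF th(1,2)] by blast
    have "j \<notin> Q" using B(2) disj[OF th(2,3,4)] th(5) by blast
    moreover have "1 < j" "j < N" using th(5) slots[OF th(3)] by auto
    then have "j \<notin> B" using B(3) by (auto simp: e_def)
    ultimately show ?thesis using B(1) by blast
  qed
  have new_0: "0 \<notin> \<sigma>" "\<sigma> \<subseteq> {..x'}" if "\<sigma> \<in> new s" "s < h" for \<sigma> s
  proof -
    note th = that
    obtain B Q where B: "\<sigma> = B \<union> Q" "Q \<subseteq> {c s..d s}" "B = {1,N + Suc s,e} \<or>
      (\<exists>i. N + Suc s < i \<and> i < e \<and> (B = {N + Suc s,i,Suc i} \<or> B = {1,N + Suc s,i,Suc i}))"
      using newE[OF th(1,2)] by blast
    have "0 \<notin> Q" "Q \<subseteq> {..x'}" using B(2) slots[OF th(2)] by (auto simp: x'_def)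
    moreover have "0 \<notin> B" "B \<subseteq> {..x'}" using B(3) th(2) by (auto simp: e_def x'_def)
    ultimately show "0 \<notin> \<sigma>" "\<sigma> \<subseteq> {..x'}" using B(1) by auto
  qed
  \<comment> \<open>Apart from its own apex, a facet of an earlier fan has only consecutive block
    vertices or just \<open>e\<close>, so the diagonals at a later apex are still free.\<close>
  have new_chord: "\<not> {N + Suc k, i} \<subseteq> \<sigma>"
    if "\<sigma> \<in> new s" "s < k" "Suc k < h" "Suc (N + Suc k) < i" "i \<le> e" for \<sigma> s k i
  proof -
    note th = that
    have sh: "s < h" using th by simp
    obtain B Q where B: "\<sigma> = B \<union> Q" "Q \<subseteq> {c s..d s}" "B = {1,N + Suc s,e} \<or>
      (\<exists>i. N + Suc s < i \<and> i < e \<and> (B = {N + Suc s,i,Suc i} \<or> B = {1,N + Suc s,i,Suc i}))"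
      using newE[OF th(1) sh] by blast
    have "N + Suc k \<notin> Q" "i \<notin> Q" using B(2) slots[OF sh] th(4) by auto
    moreover have "N + Suc k \<notin> B \<or> i \<notin> B" using B(3) th N by (auto simp: e_def)
    ultimately show ?thesis using B(1) by blast
  qed
  have F4_mid: "\<exists>i' z \<epsilon>. N \<le> i' \<and> i' < x \<and> z \<in> {1,2} \<and> \<epsilon> \<in> edges 5 (N - 1) \<union> {{x',N - 1}, {5,0}, {x',0}} \<and>
      \<sigma> = {i',Suc i'} \<union> insert z \<epsilon>" if s: "\<sigma> \<in> F4" "i \<in> \<sigma>" "N < i" "i \<le> e" for \<sigma> i
  proof -
    have "\<sigma> \<notin> P" using PV s(2-4) by (auto simp: e_def x_def)
    then obtain i' l where "N \<le> i'" "i' < x" "l \<in> L" "\<sigma> = {i',Suc i'} \<union> l"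
      using s(1) unfolding F4 by auto
    then show ?thesis unfolding L joins_def by blast
  qed
  have link_small: "v < N \<or> v = x'" if "\<epsilon> \<in> edges 5 (N - 1) \<union> {{x',N - 1}, {5,0}, {x',0}}" "v \<in> \<epsilon>" for \<epsilon> v
    using that N by (auto simp: edges_def)
  have F4_chord: "\<not> {r, i} \<subseteq> \<sigma>" if s: "\<sigma> \<in> F4" "N < r" "Suc r < i" "i \<le> e" for \<sigma> r i
  proof
    assume r: "{r,i} \<subseteq> \<sigma>"
    then obtain i' z \<epsilon> where i': "z \<in> {1,2}" "\<epsilon> \<in> edges 5 (N - 1) \<union> {{x',N - 1}, {5,0}, {x',0}}"
      "\<sigma> = {i',Suc i'} \<union> insert z \<epsilon>"
      using F4_mid[OF s(1), of r] s by auto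
    have "r \<notin> \<epsilon>" "i \<notin> \<epsilon>" using link_small[OF i'(2), of r] link_small[OF i'(2), of i] s by (auto simp: e_def x'_def)
    moreover have "r \<noteq> z" "i \<noteq> z" using i'(1) s N by auto
    ultimately show False using r s(3) i'(3) by auto
  qed
  \<comment> \<open>A facet that would obstruct the fan flip is one of those about to be exchanged.
    An end of the interval also lies in link edges leaving the interval, such as
    \<open>{5, 0}\<close>; hence \<open>j\<close> has to be an inner vertex or come together with
    \<open>Suc j\<close>.\<close>
  have F4_old: "\<sigma> \<in> old k" if s: "\<sigma> \<in> F4" "Suc k < h" "N + Suc k < i" "i < e" "{1,i,j} \<subseteq> \<sigma>"
    and j: "c k < j \<and> j < d k \<or> c k \<le> j \<and> j < d k \<and> Suc j \<in> \<sigma>" for \<sigma> k i j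
  proof -
    have "5 \<le> c k" "d k < N" using slots[of k] s(2) by auto
    have si: "i \<in> \<sigma>" "N < i" "i \<le> e" using s by auto
    obtain i' z \<epsilon> where i': "z \<in> {1,2}" "\<epsilon> \<in> edges 5 (N - 1) \<union> {{x',N - 1}, {5,0}, {x',0}}"
      "\<sigma> = {i',Suc i'} \<union> insert z \<epsilon>" "N \<le> i'"
      using F4_mid[OF s(1) si] by (elim exE conjE)
    have jb: "5 \<le> j" "j < N - 1" using j \<open>5 \<le> c k\<close> \<open>d k < N\<close> by auto
    have "1 \<notin> \<epsilon>" using i'(2) N by (auto simp: edges_def x'_def)
    then have z: "z = 1" using i' s(5) N by auto
    have "i \<notin> \<epsilon>" using link_small[OF i'(2), of i] s by (auto simp: e_def x'_def)
    then have ii: "i = i' \<or> i = Suc i'" using i'(3) s(3,5) z N by auto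
    have je: "j \<in> \<epsilon>" using i'(3,4) s(5) jb z by auto
    have sje: "Suc j \<in> \<epsilon>" if "Suc j \<in> \<sigma>" using i'(3,4) that jb z by auto
    have "\<epsilon> \<noteq> {x',N - 1}" "\<epsilon> \<noteq> {x',0}" using je jb by (auto simp: x'_def)
    moreover have "\<epsilon> \<noteq> {5,0}" using je sje j \<open>5 \<le> c k\<close> by auto
    ultimately have "\<epsilon> \<in> edges 5 (N - 1)" using i'(2) by blast
    then obtain j' where j': "\<epsilon> = {j',Suc j'}" unfolding edges_def by auto
    have "c k \<le> j' \<and> j' < d k" using j
    proof
      assume "c k < j \<and> j < d k" then show ?thesis using je j' by auto
    next
      assume "c k \<le> j \<and> j < d k \<and> Suc j \<in> \<sigma>"
      then show ?thesis using je sje j' by auto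
    qed
    moreover have "N + Suc k \<le> i' \<and> i' < e" using ii s by auto
    moreover have "\<sigma> = {1,i',Suc i',j',Suc j'}" using i'(3) z j' by auto
    ultimately show ?thesis unfolding old_def by (intro UN_I[of i'] image_eqI[of _ _ j']) auto
  qed
  have old_F4: "old k \<subseteq> F4" if "k < h" for k
  proof
    fix \<sigma> assume "\<sigma> \<in> old k"
    then obtain i j where ij: "N + Suc k \<le> i" "i < e" "c k \<le> j" "j < d k" "\<sigma> = {1,i,Suc i,j,Suc j}"
      using oldE by blast
    then have "{j,Suc j} \<in> edges 5 (N - 1)" using slots[OF that] unfolding edges_def by auto
    then have "insert 1 {j,Suc j} \<in> L" unfolding L joins_def by blast
    moreover have "\<sigma> = {i,Suc i} \<union> insert 1 {j,Suc j}" using ij by auto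
    ultimately have "\<sigma> \<in> (\<lambda>l. {i,Suc i} \<union> l) ` L" by blast
    moreover have "i \<in> {N..<x}" using ij by (auto simp: e_def x_def)
    ultimately show "\<sigma> \<in> F4" unfolding F4 by blast
  qed
  have old_disj: "\<sigma> \<notin> old t" if "\<sigma> \<in> old s" "s < h" "t < h" "s \<noteq> t" for \<sigma> s t
  proof
    note th = that
    assume "\<sigma> \<in> old t"
    then obtain i j where ij: "c t \<le> j" "j < d t" "\<sigma> = {1,i,Suc i,j,Suc j}" using oldE by blast
    obtain i' j' where ij': "N + Suc s \<le> i'" "c s \<le> j'" "j' < d s" "\<sigma> = {1,i',Suc i',j',Suc j'}" using oldE[OF th(1)] by blast
    have "j \<in> {1,i',Suc i',j',Suc j'}" using ij(3) ij'(4) by blast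
    moreover have "1 < j" "j < N" using ij slots[OF th(3)] by auto
    ultimately have "j = j' \<or> j = Suc j'" using ij'(1) by auto
    then have "j \<in> {c s..d s}" using ij' by auto
    moreover have "j \<in> {c t..d t}" using ij by auto
    ultimately show False using disj[OF th(2-4)] by blast
  qed
  define inv where "inv k G \<longleftrightarrow> facet_sphere 4 G \<and> (\<forall>\<sigma>\<in>G. \<sigma> \<in> F4 \<or> (\<exists>s<k. \<sigma> \<in> new s)) \<and>
      (\<forall>\<sigma>\<in>F4. (\<forall>s<k. \<sigma> \<notin> old s) \<longrightarrow> \<sigma> \<in> G) \<and> (\<forall>s<k. new s \<subseteq> G)" for k G
  \<comment> \<open>The apex with index \<open>h - 1\<close> is \<open>e\<close> itself and has no
    fan, so \<open>h - 1\<close> fans suffice. The case \<open>h = 0\<close> is included.\<close>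
  have "\<exists>G. inv k G" if "k = 0 \<or> k < h" for k
    using that
  proof (induction k)
    case 0
    have "inv 0 F4" unfolding inv_def using S4 by simp
    then show ?case ..
  next
    case (Suc k)
    then have k: "Suc k < h" "k < h" by auto
    obtain G where I: "inv k G" using Suc.IH k(2) by blast
    note G = I[unfolded inv_def, THEN conjunct1]
      and a = I[unfolded inv_def, THEN conjunct2, THEN conjunct1, THEN bspec]
      and b = I[unfolded inv_def, THEN conjunct2, THEN conjunct2, THEN conjunct1, THEN bspec, THEN mp]
      and c = I[unfolded inv_def, THEN conjunct2, THEN conjunct2, THEN conjunct2, THEN spec, THEN mp]
    define A where "A = G - old k"
    have "old k \<subseteq> G"
    proof
      fix \<sigma> assume o: "\<sigma> \<in> old k"
      have "\<forall>s<k. \<sigma> \<notin> old s"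
      proof (intro allI impI)
        fix s assume "s < k"
        then show "\<sigma> \<notin> old s" using old_disj[OF o k(2), of s] k(2) by simp
      qed
      moreover have "\<sigma> \<in> F4" using o old_F4[OF k(2)] by (rule subsetD[rotated])
      ultimately show "\<sigma> \<in> G" by (rule b[rotated])
    qed
    then have GA: "G = A \<union> (\<Union>i\<in>{N + Suc k..<e}. (\<lambda>j. {1,i,Suc i,j,Suc j}) ` {c k..<d k})"
      unfolding A_def old_def[symmetric] by blast
    have AE: "\<sigma> \<in> F4 \<and> \<sigma> \<notin> old k \<or> (\<exists>s<k. \<sigma> \<in> new s)" if "\<sigma> \<in> A" for \<sigma>
      using a that unfolding A_def by blast
    have sl: "5 \<le> c k" "c k < d k" "d k < N" using slots[OF k(2)] by auto
    have ns: "j \<notin> \<sigma>" if "\<exists>s<k. \<sigma> \<in> new s" "c k \<le> j" "j \<le> d k" for \<sigma> j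
    proof -
      from that(1) obtain s where s: "s < k" "\<sigma> \<in> new s" by blast
      then have "s < h" "s \<noteq> k" using k by auto
      then show ?thesis using new_slot[OF s(2) _ k(2)] that(2,3) by simp
    qed
    have "facet_sphere 4 (A \<union> new k)"
      unfolding new_def Un_assoc[symmetric]
    proof (rule fan_flip)
      show "facet_sphere 4 (A \<union> (\<Union>i\<in>{N + Suc k..<e}. (\<lambda>j. {1,i,Suc i,j,Suc j}) ` {c k..<d k}))"
        using G GA by simp
      show "1 < c k" "c k < d k" "d k < N + Suc k" "N + Suc k < e" using sl k by (auto simp: e_def)
      show "\<not> {1,i,j,Suc j} \<subseteq> \<sigma>" if "\<sigma> \<in> A" "N + Suc k < i" "i < e" "c k \<le> j" "j < d k" for \<sigma> i j
      proof
        assume sub: "{1,i,j,Suc j} \<subseteq> \<sigma>"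
        from AE[OF that(1)] show False
        proof
          assume "\<sigma> \<in> F4 \<and> \<sigma> \<notin> old k"
          then show False using F4_old[of \<sigma> k i j] sub that(2-5) k by simp
        next
          assume "\<exists>s<k. \<sigma> \<in> new s"
          then show False using ns[of \<sigma> j] sub that(4,5) by simp
        qed
      qed
      show "\<not> {1,i,j} \<subseteq> \<sigma>" if "\<sigma> \<in> A" "N + Suc k < i" "i < e" "c k < j" "j < d k" for \<sigma> i j
      proof
        assume sub: "{1,i,j} \<subseteq> \<sigma>"
        from AE[OF that(1)] show False
        proof
          assume "\<sigma> \<in> F4 \<and> \<sigma> \<notin> old k"
          then show False using F4_old[of \<sigma> k i j] sub that(2-5) k by simp
        next
          assume "\<exists>s<k. \<sigma> \<in> new s"
          then show False using ns[of \<sigma> j] sub that(4,5) by simp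
        qed
      qed
      show "\<not> {N + Suc k,i} \<subseteq> \<sigma>" if "\<sigma> \<in> A" "Suc (N + Suc k) < i" "i \<le> e" for \<sigma> i
        using AE[OF that(1)]
      proof
        assume "\<sigma> \<in> F4 \<and> \<sigma> \<notin> old k"
        then show ?thesis using F4_chord[of \<sigma> "N + Suc k" i] that(2,3) by simp
      next
        assume "\<exists>s<k. \<sigma> \<in> new s"
        then show ?thesis using new_chord[OF _ _ k(1) that(2,3)] by blast
      qed
    qed
    moreover have "\<forall>\<sigma>\<in>A \<union> new k. \<sigma> \<in> F4 \<or> (\<exists>s<Suc k. \<sigma> \<in> new s)"
      using AE less_Suc_eq by blast
    moreover have "\<forall>\<sigma>\<in>F4. (\<forall>s<Suc k. \<sigma> \<notin> old s) \<longrightarrow> \<sigma> \<in> A \<union> new k"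
      using b unfolding A_def by (simp add: less_Suc_eq)
    moreover have "\<forall>s<Suc k. new s \<subseteq> A \<union> new k"
    proof (intro allI impI)
      fix s assume "s < Suc k"
      then consider "s = k" | "s < k" by linarith
      then show "new s \<subseteq> A \<union> new k"
      proof cases
        case 2
        have "\<sigma> \<notin> old k" if "\<sigma> \<in> new s" for \<sigma>
        proof
          assume "\<sigma> \<in> old k"
          then obtain i j where "c k \<le> j" "j < d k" "\<sigma> = {1,i,Suc i,j,Suc j}" using oldE by blast
          then show False using ns[of \<sigma> j] that 2 by auto
        qed
        then show ?thesis using c[OF 2] unfolding A_def by blast
      qed simp
    qed
    ultimately have "inv (Suc k) (A \<union> new k)" unfolding inv_def by (intro conjI)
    then show ?case ..
  qed
  moreover have "h - 1 = 0 \<or> h - 1 < h" by linarith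
  ultimately obtain G where I: "inv (h - 1) G" by blast
  note G = I[unfolded inv_def, THEN conjunct1]
    and a = I[unfolded inv_def, THEN conjunct2, THEN conjunct1, THEN bspec]
    and b = I[unfolded inv_def, THEN conjunct2, THEN conjunct2, THEN conjunct1, THEN bspec, THEN mp]
    and c = I[unfolded inv_def, THEN conjunct2, THEN conjunct2, THEN conjunct2, THEN spec, THEN mp]
  have old0: "0 \<notin> \<sigma>" "\<not> \<sigma> \<subseteq> {..N}" if "\<sigma> \<in> old s" "s < h" for \<sigma> s
    using oldE[OF that(1)] slots[OF that(2)] by auto
  \<comment> \<open>All exchanged facets avoid 0, so the place where the path is continued stays
    intact.\<close>
  have "{\<sigma> \<in> G. {0,x'} \<subseteq> \<sigma>} = {\<sigma> \<in> F4. {0,x'} \<subseteq> \<sigma>}"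
  proof (intro Collect_cong iffI conjI; elim conjE)
    fix \<sigma> assume "\<sigma> \<in> G" "{0,x'} \<subseteq> \<sigma>"
    then show "\<sigma> \<in> F4" using a[of \<sigma>] new_0(1)[of \<sigma>] by force
  next
    fix \<sigma> assume "\<sigma> \<in> F4" "{0,x'} \<subseteq> \<sigma>"
    then show "\<sigma> \<in> G" using b[of \<sigma>] old0(1)[of \<sigma>] by force
  qed
  moreover have "\<Union>G \<subseteq> {..x'}"
  proof -
    have "\<sigma> \<subseteq> {..x'}" if "\<sigma> \<in> G" for \<sigma>
      using a[OF that] new_0(2)[of \<sigma>] V4 by force
    then show ?thesis by blast
  qed
  moreover have "x' - 1 = x" "9 \<le> x'" using N by (auto simp: x_def x'_def)
  ultimately have "good G (N + h + 2)"
    using G st4 unfolding good_def x'_def[symmetric] by simp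
  moreover have "{\<sigma> \<in> F. 0 \<notin> \<sigma>} \<subseteq> G"
  proof
    fix \<sigma> assume s: "\<sigma> \<in> {\<sigma> \<in> F. 0 \<notin> \<sigma>}"
    then have "\<sigma> \<subseteq> {..N}" using VF by blast
    then have "\<forall>s<h - 1. \<sigma> \<notin> old s" using old0(2)[of \<sigma>] by force
    then show "\<sigma> \<in> G" using b s keep4 by blast
  qed
  moreover have "\<forall>s i j. s < h \<longrightarrow> N + Suc s < i \<longrightarrow> i < N + h \<longrightarrow> c s \<le> j \<longrightarrow> j < d s \<longrightarrow>
       {N + Suc s, i, Suc i, j, Suc j} \<in> G"
  proof (intro allI impI)
    fix s i j assume h: "s < h" "N + Suc s < i" "i < N + h" "c s \<le> j" "j < d s"
    then have "s < h - 1" by linarith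
    moreover have "{N + Suc s, i, Suc i, j, Suc j} \<in> new s"
      using h unfolding new_def e_def by (intro UnI1[OF UnI2] UN_I[of i] image_eqI[of _ _ j]) auto
    ultimately show "{N + Suc s, i, Suc i, j, Suc j} \<in> G" using c by blast
  qed
  ultimately show thesis by (rule that)
qed

section \<open>The density recursion\<close>

text \<open>Only facets without the vertex 0 are guaranteed to survive when the path is continued.\<close>

definition avoids :: "nat set set \<Rightarrow> nat set \<Rightarrow> bool" where
  "avoids F I \<longleftrightarrow> (\<forall>\<sigma>\<in>F. 0 \<notin> \<sigma> \<longrightarrow> \<not> \<sigma> \<subseteq> I)"

text \<open>\<open>E\<close> is a bound for twice the excess of \<open>I\<close> over half of the
  \<open>S\<close> new vertices. Uniformity in \<open>F\<close> and \<open>N\<close> allows an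
  extension to be repeated as a building block of a longer one.\<close>

definition extendable :: "nat \<Rightarrow> real \<Rightarrow> bool" where
  "extendable S E \<longleftrightarrow> (\<forall>F N. good F N \<longrightarrow> (\<exists>F'. good F' (N + S) \<and> {\<sigma> \<in> F. 0 \<notin> \<sigma>} \<subseteq> F' \<and>
     (\<forall>I. avoids F' I \<longrightarrow> 2 * real (card (I \<inter> {N<..N + S})) \<le> real S + E)))"

lemma extendableE:
  assumes "extendable S E" "good F N"
  obtains F' where "good F' (N + S)" "{\<sigma> \<in> F. 0 \<notin> \<sigma>} \<subseteq> F'"
    "\<And>I. avoids F' I \<Longrightarrow> 2 * real (card (I \<inter> {N<..N + S})) \<le> real S + E"
  using assms unfolding extendable_def by blast

lemma avoids_antimono:
  assumes "{\<sigma> \<in> F. 0 \<notin> \<sigma>} \<subseteq> F'" "avoids F' I"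
  shows "avoids F I"
  using assms by (auto simp: avoids_def)

lemma card_Int_split:
  fixes I :: "nat set"
  shows "card (I \<inter> {N<..N + (a + b)}) = card (I \<inter> {N<..N + a}) + card (I \<inter> {N + a<..N + a + b})"
proof -
  have "I \<inter> {N<..N + (a + b)} = (I \<inter> {N<..N + a}) \<union> (I \<inter> {N + a<..N + a + b})" by auto
  then show ?thesis by (simp add: card_Un_disjoint disjoint_iff)
qed

section \<open>Composition of extensions\<close>

lemma extendable_0: "extendable 0 0"
  unfolding extendable_def by auto

lemma extendable_add:
  assumes 1: "extendable S E" and 2: "extendable S' E'"
  shows "extendable (S + S') (E + E')"
  unfolding extendable_def
proof (intro allI impI)
  fix F N assume "good F N"
  then obtain F1 where F1: "good F1 (N + S)" "{\<sigma> \<in> F. 0 \<notin> \<sigma>} \<subseteq> F1"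
    "\<And>I. avoids F1 I \<Longrightarrow> 2 * real (card (I \<inter> {N<..N + S})) \<le> real S + E"
    using extendableE[OF 1] by blast
  obtain F2 where F2: "good F2 (N + S + S')" "{\<sigma> \<in> F1. 0 \<notin> \<sigma>} \<subseteq> F2"
    "\<And>I. avoids F2 I \<Longrightarrow> 2 * real (card (I \<inter> {N + S<..N + S + S'})) \<le> real S' + E'"
    using extendableE[OF 2 F1(1)] by blast
  have "2 * real (card (I \<inter> {N<..N + (S + S')})) \<le> real (S + S') + (E + E')" if "avoids F2 I" for I
    using F1(3)[OF avoids_antimono[OF F2(2) that]] F2(3)[OF that] by (simp add: card_Int_split)
  note bound = this
  have keep: "{\<sigma> \<in> F. 0 \<notin> \<sigma>} \<subseteq> F2" using F1(2) F2(2) by blast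
  have "good F2 (N + (S + S'))" using F2(1) by (simp only: add.assoc)
  then show "\<exists>F'. good F' (N + (S + S')) \<and> {\<sigma> \<in> F. 0 \<notin> \<sigma>} \<subseteq> F' \<and>
     (\<forall>I. avoids F' I \<longrightarrow> 2 * real (card (I \<inter> {N<..N + (S + S')})) \<le> real (S + S') + (E + E'))"
    using keep by (intro exI[of _ F2] conjI allI impI bound)
qed

lemma extendable_mult:
  assumes "extendable S E"
  shows "extendable (k * S) (real k * E)"
proof (induction k)
  case 0 show ?case using extendable_0 by simp
next
  case (Suc k) then show ?case using extendable_add[OF assms Suc] by (simp add: algebra_simps)
qed

text \<open>An empty block appends just its two closing vertices. The trivial count gives the
  relative excess 1 with which the iteration starts.\<close>

lemma extendable_2: "extendable 2 2"
  unfolding extendable_def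
proof (intro allI impI)
  fix F N assume "good F N"
  then obtain F' where F': "good F' (N + 2)" "{\<sigma> \<in> F. 0 \<notin> \<sigma>} \<subseteq> F'"
    by (rule block_step[of F N 0]) auto
  have "2 * real (card (I \<inter> {N<..N + 2})) \<le> real 2 + 2" for I
  proof -
    have "card (I \<inter> {N<..N + 2}) \<le> card {N<..N + 2}" by (intro card_mono) auto
    then show ?thesis by simp
  qed
  then show "\<exists>F'. good F' (N + 2) \<and> {\<sigma> \<in> F. 0 \<notin> \<sigma>} \<subseteq> F' \<and>
     (\<forall>I. avoids F' I \<longrightarrow> 2 * real (card (I \<inter> {N<..N + 2})) \<le> real 2 + 2)"
    using F' by (intro exI[of _ F'] conjI allI impI)
qed

lemma card_no_consecutive:
  fixes I :: "nat set"
  assumes "\<And>i. p \<le> i \<Longrightarrow> Suc i < p + n \<Longrightarrow> i \<in> I \<Longrightarrow> Suc i \<notin> I"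
  shows "2 * card (I \<inter> {p..<p + n}) \<le> n + 1"
  using assms
proof (induction n rule: less_induct)
  case (less n)
  consider "n = 0" | "n = 1" | m where "n = m + 2" by (metis One_nat_def Suc_eq_plus1 add_2_eq_Suc' not0_implies_Suc)
  then show ?case
  proof cases
    case 2
    have "card (I \<inter> {p..<p + 1}) \<le> card {p}" by (intro card_mono) auto
    then show ?thesis using 2 by simp
  next
    case (3 m)
    have "2 * card (I \<inter> {p..<p + m}) \<le> m + 1" using less 3 by simp
    moreover have "card (I \<inter> {p + m, Suc (p + m)}) \<le> 1"
    proof -
      have "I \<inter> {p + m, Suc (p + m)} \<subseteq> {p + m} \<or> I \<inter> {p + m, Suc (p + m)} \<subseteq> {Suc (p + m)}"
        using less.prems[of "p + m"] 3 by auto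
      then show ?thesis
        by (metis card.empty card_insert_disjoint card_mono empty_iff finite.emptyI finite_insert One_nat_def)
    qed
    moreover have "I \<inter> {p..<p + n} = (I \<inter> {p..<p + m}) \<union> (I \<inter> {p + m, Suc (p + m)})"
      using 3 by auto
    then have "card (I \<inter> {p..<p + n}) \<le> card (I \<inter> {p..<p + m}) + card (I \<inter> {p + m, Suc (p + m)})"
      by (simp add: card_Un_le)
    ultimately show ?thesis using 3 by linarith
  qed simp
qed

text \<open>Unlike \<open>extendable_mult\<close>, this keeps a bound for every single copy, since
  one sparse copy has to be singled out later.\<close>

lemma extend_children:
  assumes ext: "extendable C E" and g: "good F N"
  shows "\<exists>F'. good F' (N + k * C) \<and> {\<sigma> \<in> F. 0 \<notin> \<sigma>} \<subseteq> F' \<and>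
    (\<forall>I. avoids F' I \<longrightarrow> (\<forall>s<k. 2 * real (card (I \<inter> {N + s * C<..N + s * C + C})) \<le> real C + E))"
proof (induction k)
  case 0 then show ?case using g by auto
next
  case (Suc k)
  then obtain F1 where F1: "good F1 (N + k * C)" "{\<sigma> \<in> F. 0 \<notin> \<sigma>} \<subseteq> F1"
    "\<And>I s. avoids F1 I \<Longrightarrow> s < k \<Longrightarrow> 2 * real (card (I \<inter> {N + s * C<..N + s * C + C})) \<le> real C + E" by blast
  obtain F2 where F2: "good F2 (N + k * C + C)" "{\<sigma> \<in> F1. 0 \<notin> \<sigma>} \<subseteq> F2"
    "\<And>I. avoids F2 I \<Longrightarrow> 2 * real (card (I \<inter> {N + k * C<..N + k * C + C})) \<le> real C + E"
    using extendableE[OF ext F1(1)] by blast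
  have "2 * real (card (I \<inter> {N + s * C<..N + s * C + C})) \<le> real C + E" if "avoids F2 I" "s < Suc k" for I s
    using F1(3)[OF avoids_antimono[OF F2(2) that(1)], of s] F2(3)[OF that(1)] that(2) by (cases "s = k") auto
  note bound = this
  have keep: "{\<sigma> \<in> F. 0 \<notin> \<sigma>} \<subseteq> F2" using F1(2) F2(2) by blast
  have "N + Suc k * C = N + k * C + C" by simp
  then have "good F2 (N + Suc k * C)" using F2(1) by (simp only:)
  then show ?case using keep by (intro exI[of _ F2] conjI allI impI bound)
qed

text \<open>All blocks can share the same intervals, because the edges of each new block bring their
  own facets over the older path.\<close>

lemma extend_blocks:
  fixes c d :: "nat \<Rightarrow> nat"
  assumes g: "good F M"
    and slots: "\<And>s. s < h \<Longrightarrow> 5 \<le> c s \<and> c s < d s \<and> d s < M"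
    and disj: "\<And>s t. s < h \<Longrightarrow> t < h \<Longrightarrow> s \<noteq> t \<Longrightarrow> {c s..d s} \<inter> {c t..d t} = {}"
  shows "\<exists>F'. good F' (M + k * (h + 2)) \<and> {\<sigma> \<in> F. 0 \<notin> \<sigma>} \<subseteq> F' \<and>
    (\<forall>t<k. \<forall>s<h. \<forall>i j. M + t * (h + 2) + Suc s < i \<longrightarrow> i < M + t * (h + 2) + h \<longrightarrow> c s \<le> j \<longrightarrow> j < d s \<longrightarrow>
       {M + t * (h + 2) + Suc s, i, Suc i, j, Suc j} \<in> F')"
proof (induction k)
  case 0 then show ?case using g by auto
next
  case (Suc k)
  then obtain F1 where F1: "good F1 (M + k * (h + 2))" "{\<sigma> \<in> F. 0 \<notin> \<sigma>} \<subseteq> F1"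
    "\<And>t s i j. t < k \<Longrightarrow> s < h \<Longrightarrow> M + t * (h + 2) + Suc s < i \<Longrightarrow> i < M + t * (h + 2) + h \<Longrightarrow> c s \<le> j \<Longrightarrow> j < d s \<Longrightarrow>
       {M + t * (h + 2) + Suc s, i, Suc i, j, Suc j} \<in> F1" by blast
  have sl: "5 \<le> c s \<and> c s < d s \<and> d s < M + k * (h + 2)" if "s < h" for s
    using slots[OF that] by auto
  obtain F2 where F2: "good F2 (M + k * (h + 2) + h + 2)" "{\<sigma> \<in> F1. 0 \<notin> \<sigma>} \<subseteq> F2"
    "\<forall>s i j. s < h \<longrightarrow> M + k * (h + 2) + Suc s < i \<longrightarrow> i < M + k * (h + 2) + h \<longrightarrow> c s \<le> j \<longrightarrow> j < d s \<longrightarrow>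
       {M + k * (h + 2) + Suc s, i, Suc i, j, Suc j} \<in> F2"
    by (rule block_step[OF F1(1) sl disj])
  have "{M + t * (h + 2) + Suc s, i, Suc i, j, Suc j} \<in> F2"
    if "t < Suc k" "s < h" "M + t * (h + 2) + Suc s < i" "i < M + t * (h + 2) + h" "c s \<le> j" "j < d s" for t s i j
  proof (cases "t = k")
    case True then show ?thesis using F2(3) that by simp
  next
    case False
    then have "{M + t * (h + 2) + Suc s, i, Suc i, j, Suc j} \<in> F1" using F1(3) that by simp
    moreover have "0 \<notin> {M + t * (h + 2) + Suc s, i, Suc i, j, Suc j}" using that slots[OF that(2)] by auto
    ultimately show ?thesis using F2(2) by blast
  qed
  note fac = this
  have keep: "{\<sigma> \<in> F. 0 \<notin> \<sigma>} \<subseteq> F2" using F1(2) F2(2) by blast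
  have "M + Suc k * (h + 2) = M + k * (h + 2) + h + 2" by simp
  then have "good F2 (M + Suc k * (h + 2))" using F2(1) by (simp only:)
  then show ?case
    using keep by (intro exI[of _ F2] conjI allI impI fac)
qed

lemma card_Int_blocks:
  fixes I :: "nat set"
  shows "card (I \<inter> {N<..N + k * C}) = (\<Sum>s<k. card (I \<inter> {N + s * C<..N + s * C + C}))"
proof (induction k)
  case (Suc k)
  show ?case using card_Int_split[of I N "k * C" C] Suc by (simp add: add.commute)
qed simp

text \<open>The path is extended by \<open>h\<close> copies of a given extension of length \<open>C\<close>, followed by \<open>g\<close> blocks whose
  fans run over these copies. \<open>A\<close> covers the case that \<open>I\<close> has two consecutive vertices in each copy, and
  \<open>B\<close> the case that it has none in some copy.\<close>

lemma extendable_combine: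
  assumes ext: "extendable C E" and C: "3 \<le> C"
    and A: "4 * real g + real h * E \<le> E'" and B: "real (g * (h + 2)) + 3 + (real h - 1) * E \<le> E'"
  shows "extendable (h * C + g * (h + 2)) E'"
  unfolding extendable_def
proof (intro allI impI)
  fix F N assume good: "good F N"
  obtain F1 where F1: "good F1 (N + h * C)" "{\<sigma> \<in> F. 0 \<notin> \<sigma>} \<subseteq> F1"
    "\<And>I s. avoids F1 I \<Longrightarrow> s < h \<Longrightarrow> 2 * real (card (I \<inter> {N + s * C<..N + s * C + C})) \<le> real C + E"
    using extend_children[OF ext good] by blast
  define M where "M = N + h * C"
  \<comment> \<open>The interval leaves out the last vertex of its copy, so that even the last
    interval ends before \<open>M\<close>.\<close>
  define c where "c s = N + s * C + 1" for s
  define d where "d s = N + s * C + C - 1" for s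
  have N: "9 \<le> N" using good by (simp add: good_def)
  have step: "s * C + C \<le> t * C" if "s < t" for s t
    using mult_le_mono1[of "Suc s" t C] that by simp
  have slots: "5 \<le> c s \<and> c s < d s \<and> d s < M" if "s < h" for s
    using step[OF that] N C by (auto simp: c_def d_def M_def)
  have disj: "{c s..d s} \<inter> {c t..d t} = {}" if "s < h" "t < h" "s \<noteq> t" for s t
    using step[of s t] step[of t s] that(3) C by (cases s t rule: linorder_cases) (auto simp: c_def d_def)
  have "\<exists>F'. good F' (M + g * (h + 2)) \<and> {\<sigma> \<in> F1. 0 \<notin> \<sigma>} \<subseteq> F' \<and>
    (\<forall>t<g. \<forall>s<h. \<forall>i j. M + t * (h + 2) + Suc s < i \<longrightarrow> i < M + t * (h + 2) + h \<longrightarrow> c s \<le> j \<longrightarrow> j < d s \<longrightarrow>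
       {M + t * (h + 2) + Suc s, i, Suc i, j, Suc j} \<in> F')"
  proof (rule extend_blocks[OF F1(1)[folded M_def]])
    show "5 \<le> c s \<and> c s < d s \<and> d s < M" if "s < h" for s using slots[OF that] .
    show "{c s..d s} \<inter> {c t..d t} = {}" if "s < h" "t < h" "s \<noteq> t" for s t using disj[OF that] .
  qed
  then obtain F2 where F2: "good F2 (M + g * (h + 2))" "{\<sigma> \<in> F1. 0 \<notin> \<sigma>} \<subseteq> F2"
    and fac': "\<forall>t<g. \<forall>s<h. \<forall>i j. M + t * (h + 2) + Suc s < i \<longrightarrow> i < M + t * (h + 2) + h \<longrightarrow> c s \<le> j \<longrightarrow> j < d s \<longrightarrow>
       {M + t * (h + 2) + Suc s, i, Suc i, j, Suc j} \<in> F2"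
    by (elim exE conjE)
  note fac = fac'[rule_format]
  have bound: "2 * real (card (I \<inter> {N<..N + (h * C + g * (h + 2))})) \<le> real (h * C + g * (h + 2)) + E'"
    if av: "avoids F2 I" for I
  proof -
    define ch where "ch s = real (card (I \<inter> {N + s * C<..N + s * C + C}))" for s
    define bl where "bl t = real (card (I \<inter> {M + t * (h + 2)<..M + t * (h + 2) + (h + 2)}))" for t
    have tot: "real (card (I \<inter> {N<..N + (h * C + g * (h + 2))})) = (\<Sum>s<h. ch s) + (\<Sum>t<g. bl t)"
    proof -
      have "card (I \<inter> {N<..N + (h * C + g * (h + 2))}) = card (I \<inter> {N<..N + h * C}) + card (I \<inter> {M<..M + g * (h + 2)})"
        unfolding M_def by (rule card_Int_split)
      then show ?thesis unfolding ch_def bl_def by (simp only: card_Int_blocks of_nat_add of_nat_sum)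
    qed
    have chb: "2 * ch s \<le> real C + E" if "s < h" for s
      using F1(3)[OF avoids_antimono[OF F2(2) av] that] by (simp add: ch_def)
    show ?thesis
    proof (cases "\<forall>s<h. \<exists>j. c s \<le> j \<and> j < d s \<and> j \<in> I \<and> Suc j \<in> I")
      case True
      \<comment> \<open>Behind the first vertex \<open>r\<close> of \<open>I\<close> in the block,
        twice the count is at most \<open>h\<close>. The vertex \<open>r\<close> and the two closing
        vertices add at most 6, of which 2 is the share of the closing vertices in the length
        \<open>h + 2\<close>; this leaves the excess 4.\<close>
      have "2 * bl t \<le> real (h + 2) + 4" if t: "t < g" for t
      proof -
        define m where "m = M + t * (h + 2)"
        have "2 * card (I \<inter> {m<..m + h}) \<le> h + 2"
        proof (cases "I \<inter> {m<..m + h} = {}")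
          case False
          define r where "r = Min (I \<inter> {m<..m + h})"
          have r: "r \<in> I" "m < r" "r \<le> m + h" and rmin: "\<And>i. i \<in> I \<Longrightarrow> m < i \<Longrightarrow> i \<le> m + h \<Longrightarrow> r \<le> i"
            using Min_in[of "I \<inter> {m<..m + h}"] False unfolding r_def by auto
          define s where "s = r - Suc m"
          have s: "r = m + Suc s" "s < h" using r by (auto simp: s_def)
          obtain j where j: "c s \<le> j" "j < d s" "j \<in> I" "Suc j \<in> I" using True s(2) by blast
          have nc: "Suc i \<notin> I" if "Suc r \<le> i" "Suc i < Suc r + (m + h - r)" "i \<in> I" for i
          proof
            assume "Suc i \<in> I"
            have f: "{m + Suc s, i, Suc i, j, Suc j} \<in> F2"
              using fac[OF t s(2), of i j] that j s unfolding m_def by simp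
            have "{m + Suc s, i, Suc i, j, Suc j} \<subseteq> I" using r(1) s(1) j that(3) \<open>Suc i \<in> I\<close> by simp
            moreover have "0 \<notin> {m + Suc s, i, Suc i, j, Suc j}" using that j(1) by (auto simp: c_def)
            ultimately show False using av[unfolded avoids_def, THEN bspec, OF f] by simp
          qed
          have "I \<inter> {m<..m + h} \<subseteq> insert r (I \<inter> {Suc r..<Suc r + (m + h - r)})"
            using rmin r by fastforce
          then have "card (I \<inter> {m<..m + h}) \<le> card (insert r (I \<inter> {Suc r..<Suc r + (m + h - r)}))"
            by (intro card_mono) auto
          also have "\<dots> \<le> Suc (card (I \<inter> {Suc r..<Suc r + (m + h - r)}))" by (simp add: card_insert_if)
          finally have 1: "card (I \<inter> {m<..m + h}) \<le> Suc (card (I \<inter> {Suc r..<Suc r + (m + h - r)}))" .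
          have "2 * card (I \<inter> {Suc r..<Suc r + (m + h - r)}) \<le> m + h - r + 1"
            by (rule card_no_consecutive) (rule nc)
          then have "2 * card (I \<inter> {Suc r..<Suc r + (m + h - r)}) \<le> h" using r(2,3) by linarith
          then show ?thesis using 1 by simp
        qed simp
        moreover have "card (I \<inter> {m<..m + (h + 2)}) \<le> card (I \<inter> {m<..m + h}) + 2"
        proof -
          have "card (I \<inter> {m + h<..m + h + 2}) \<le> card {m + h<..m + h + 2}" by (intro card_mono) auto
          then show ?thesis unfolding card_Int_split by simp
        qed
        ultimately have "2 * card (I \<inter> {m<..m + (h + 2)}) \<le> h + 2 + 4" by linarith
        then show ?thesis unfolding bl_def m_def by linarith
      qed
      then have "2 * (\<Sum>t<g. bl t) \<le> (\<Sum>t<g. real (h + 2) + 4)"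
        unfolding sum_distrib_left by (intro sum_mono) auto
      moreover have "2 * (\<Sum>s<h. ch s) \<le> (\<Sum>s<h. real C + E)"
        unfolding sum_distrib_left using chb by (intro sum_mono) auto
      ultimately show ?thesis using A unfolding tot by (simp add: algebra_simps)
    next
      case False
      then obtain s0 where s0: "s0 < h" "\<And>j. c s0 \<le> j \<Longrightarrow> j < d s0 \<Longrightarrow> j \<in> I \<Longrightarrow> Suc j \<notin> I" by blast
      \<comment> \<open>Twice the count is at most \<open>C\<close> on the interval, which has
        \<open>C - 1\<close> vertices; the omitted last vertex of the copy adds at most 2, which the
        3 covers.\<close>
      have ch0: "2 * ch s0 \<le> real C + 3"
      proof -
        let ?J = "{c s0..<c s0 + (C - 1)}"
        have "2 * card (I \<inter> ?J) \<le> C - 1 + 1"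
        proof (rule card_no_consecutive)
          show "Suc i \<notin> I" if "c s0 \<le> i" "Suc i < c s0 + (C - 1)" "i \<in> I" for i
            using s0(2)[of i] that by (simp add: c_def d_def)
        qed
        moreover have "I \<inter> {N + s0 * C<..N + s0 * C + C} \<subseteq> insert (N + s0 * C + C) (I \<inter> ?J)"
          by (auto simp: c_def)
        then have "card (I \<inter> {N + s0 * C<..N + s0 * C + C}) \<le> card (insert (N + s0 * C + C) (I \<inter> ?J))"
          by (intro card_mono) auto
        moreover have "card (insert (N + s0 * C + C) (I \<inter> ?J)) \<le> Suc (card (I \<inter> ?J))"
          by (simp add: card_insert_if)
        ultimately have "2 * card (I \<inter> {N + s0 * C<..N + s0 * C + C}) \<le> C + 3" using C by linarith
        then show ?thesis unfolding ch_def by linarith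
      qed
      have "2 * (\<Sum>s<h. ch s) = 2 * ch s0 + 2 * (\<Sum>s\<in>{..<h} - {s0}. ch s)"
        using s0(1) by (simp add: sum.remove[of "{..<h}" s0])
      moreover have "2 * (\<Sum>s\<in>{..<h} - {s0}. ch s) \<le> (\<Sum>s\<in>{..<h} - {s0}. real C + E)"
        unfolding sum_distrib_left using chb by (intro sum_mono) auto
      moreover have "(\<Sum>s\<in>{..<h} - {s0}. real C + E) = (real h - 1) * (real C + E)"
        using s0(1) by (simp add: of_nat_diff)
      \<comment> \<open>The fans give nothing here, so the blocks are allowed to lie entirely in
        \<open>I\<close>. Their excess \<open>g * (h + 2)\<close> is paid for by the sparse copy,
        which contributes no \<open>E\<close>.\<close>
      moreover have "2 * bl t \<le> 2 * real (h + 2)" for t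
      proof -
        have "card (I \<inter> {M + t * (h + 2)<..M + t * (h + 2) + (h + 2)}) \<le> card {M + t * (h + 2)<..M + t * (h + 2) + (h + 2)}"
          by (intro card_mono) auto
        then show ?thesis by (simp add: bl_def)
      qed
      then have "2 * (\<Sum>t<g. bl t) \<le> (\<Sum>t<g. 2 * real (h + 2))"
        unfolding sum_distrib_left by (intro sum_mono) auto
      then have "2 * (\<Sum>t<g. bl t) \<le> real g * (2 * real (h + 2))" by simp
      ultimately have "2 * ((\<Sum>s<h. ch s) + (\<Sum>t<g. bl t)) \<le> real C + 3 + (real h - 1) * (real C + E) + real g * (2 * real (h + 2))"
        using ch0 by argo
      also have "\<dots> \<le> real (h * C + g * (h + 2)) + E'"
        using B by (simp add: algebra_simps)
      finally show ?thesis unfolding tot .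
    qed
  qed
  have keep: "{\<sigma> \<in> F. 0 \<notin> \<sigma>} \<subseteq> F2" using F1(2) F2(2) by blast
  have "good F2 (N + (h * C + g * (h + 2)))"
    using F2(1) unfolding M_def by (simp only: add.assoc)
  then show "\<exists>F'. good F' (N + (h * C + g * (h + 2))) \<and> {\<sigma> \<in> F. 0 \<notin> \<sigma>} \<subseteq> F' \<and>
     (\<forall>I. avoids F' I \<longrightarrow> 2 * real (card (I \<inter> {N<..N + (h * C + g * (h + 2))})) \<le> real (h * C + g * (h + 2)) + E')"
    using keep by (intro exI[of _ F2] conjI allI impI bound)
qed

section \<open>Initial sphere and iteration\<close>

lemma good_base: "\<exists>F. good F 9"
proof -
  text \<open>The cross-polytope boundary is the join of \<open>{1, 2}\<close>, the 4-cycle through 0, 9, 3, 4 and the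
    4-cycle through 5, 6, 7, 8.\<close>
  define a where "a i = [1, 0, 9, 5, 6::nat] ! i" for i
  define b where "b i = [2, 3, 4, 7, 8::nat] ! i" for i
  have at: "{..4::nat} = {0,1,2,3,4}" by auto
  have ab: "a 0 = 1" "a 1 = 0" "a 2 = 9" "a 3 = 5" "a 4 = 6" "b 0 = 2" "b 1 = 3" "b 2 = 4" "b 3 = 7" "b 4 = 8"
    by (simp_all add: a_def b_def)
  have homeo: "geometric_realization (faces (cross a b 4)) homeomorphic_space nsphere 4"
  proof (rule geometric_realization_cross)
    show "inj_on a {..4}" "inj_on b {..4}" "a ` {..4} \<inter> b ` {..4} = {}"
      unfolding at using ab ab(2,7)[unfolded One_nat_def] by simp_all
  qed
  have repr: "a ` I \<union> b ` ({..4} - I) = {if 0 \<in> I then 1 else 2, if 1 \<in> I then 0 else 3, if 2 \<in> I then 9 else 4,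
      if 3 \<in> I then 5 else 7, if 4 \<in> I then 6 else 8}" if I: "I \<subseteq> {..4}" for I :: "nat set"
  proof -
    have "a ` I \<union> b ` ({..4} - I) = (\<lambda>i. if i \<in> I then a i else b i) ` {..4}" using I by auto
    then show ?thesis unfolding at by (simp only: image_insert image_empty ab)
  qed
  have star: "{\<sigma> \<in> cross a b 4. {0,9} \<subseteq> \<sigma>} = (\<lambda>l. {0,9} \<union> l) ` joins {1,2} (edges 5 (9 - 1) \<union> {{9 - 1,5}})"
  proof -
    have e: "edges 5 (9 - 1) \<union> {{9 - 1,5}} = {{5,6},{6,7},{7,8},{8,5}}"
    proof -
      have "{5..<9 - 1} = {5,6,7::nat}" by auto
      then show ?thesis unfolding edges_def by auto
    qed
    show ?thesis
    proof (intro set_eqI iffI)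
      fix \<sigma> assume "\<sigma> \<in> {\<sigma> \<in> cross a b 4. {0,9} \<subseteq> \<sigma>}"
      then obtain I where I: "I \<subseteq> {..4}" "\<sigma> = a ` I \<union> b ` ({..4} - I)" "0 \<in> \<sigma>" "9 \<in> \<sigma>" unfolding cross_def by auto
      note r = I(2)[unfolded repr[OF I(1)]]
      have "1 \<in> I" "2 \<in> I" using I(3,4) unfolding r by (auto split: if_splits)
      then have "\<sigma> = {0,9} \<union> insert (if 0 \<in> I then 1 else 2) {if 3 \<in> I then 5 else 7, if 4 \<in> I then 6 else 8}"
        unfolding r by auto
      moreover have "{if 3 \<in> I then 5 else 7, if 4 \<in> I then 6 else 8::nat} \<in> {{5,6},{6,7},{7,8},{8,5}}" by auto
      moreover have "(if 0 \<in> I then 1 else 2) \<in> {1,2::nat}" by simp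
      ultimately show "\<sigma> \<in> (\<lambda>l. {0,9} \<union> l) ` joins {1,2} (edges 5 (9 - 1) \<union> {{9 - 1,5}})"
        unfolding e joins_def by blast
    next
      fix \<sigma> assume "\<sigma> \<in> (\<lambda>l. {0,9} \<union> l) ` joins {1,2} (edges 5 (9 - 1) \<union> {{9 - 1,5}})"
      then obtain z \<epsilon> where z: "z \<in> {1,2}" "\<epsilon> \<in> {{5,6},{6,7},{7,8},{8,5}}" "\<sigma> = {0,9} \<union> insert z \<epsilon>"
        unfolding e joins_def by blast
      define I where "I = (if z = 1 then {0} else {} :: nat set) \<union> {1,2} \<union> (if 5 \<in> \<epsilon> then {3} else {}) \<union> (if 6 \<in> \<epsilon> then {4} else {})"
      have I: "I \<subseteq> {..4}" by (auto simp: I_def)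
      have "a ` I \<union> b ` ({..4} - I) = {if z = 1 then 1 else 2, 0, 9, if 5 \<in> \<epsilon> then 5 else 7, if 6 \<in> \<epsilon> then 6 else 8}"
        unfolding repr[OF I] by (simp add: I_def)
      also have "\<dots> = \<sigma>" using z by auto
      finally have "\<sigma> \<in> cross a b 4" using I unfolding cross_def by (intro CollectI exI[of _ I] conjI) simp_all
      then show "\<sigma> \<in> {\<sigma> \<in> cross a b 4. {0,9} \<subseteq> \<sigma>}" using z(3) by simp
    qed
  qed
  have mem: "\<sigma> \<subseteq> {..9} \<and> card \<sigma> = 5" if c: "\<sigma> \<in> cross a b 4" for \<sigma>
  proof -
    obtain I where I: "I \<subseteq> {..4}" "\<sigma> = a ` I \<union> b ` ({..4} - I)" using c unfolding cross_def by auto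
    show ?thesis
      unfolding I(2) repr[OF I(1)]
      by (cases "0 \<in> I"; cases "1 \<in> I"; cases "2 \<in> I"; cases "3 \<in> I"; cases "4 \<in> I"; simp)
  qed
  then have "cross a b 4 \<subseteq> Pow {..9}" by blast
  then have "finite (cross a b 4)" by (rule finite_subset) simp
  moreover have "finite \<sigma> \<and> card \<sigma> = Suc 4" if "\<sigma> \<in> cross a b 4" for \<sigma>
    using mem[OF that] finite_subset[of \<sigma> "{..9}"] by simp
  ultimately have "facet_sphere 4 (cross a b 4)" unfolding facet_sphere_def using homeo by blast
  moreover have "\<Union>(cross a b 4) \<subseteq> {..9}" using mem by blast
  ultimately have "good (cross a b 4) 9" unfolding good_def using star by simp
  then show ?thesis ..
qed

text \<open>Taking \<open>g = S\<close> blocks, of total length \<open>U\<close>, makes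
  \<open>C = h * U\<close> both a multiple of \<open>S\<close> and \<open>h\<close> times the length
  of all blocks. The factor \<open>\<theta>\<close> cuts \<open>\<rho> * S'\<close> by half of the
  blocks' share \<open>\<rho> * U\<close>. If all fans act, this requires
  \<open>8 * S \<le> \<rho> * U\<close>, which follows from \<open>\<rho> * h \<ge> 8\<close> and is
  the origin of the threshold \<open>8 / h\<close>. Otherwise the sparse copy saves
  \<open>\<rho> * h * U\<close>, at least \<open>8 * U\<close>, while at most
  \<open>U + 3 \<le> 2 * U\<close> has to be paid.\<close>

lemma extendable_improve:
  fixes \<rho> :: real
  assumes ext: "extendable S (\<rho> * S)" and S: "1 \<le> S" and h: "1 \<le> h" and \<rho>: "8 / real h \<le> \<rho>"
  defines "\<theta> \<equiv> ((real h)\<^sup>2 + 1/2) / ((real h)\<^sup>2 + 1)"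
  shows "\<exists>S'\<ge>1. extendable S' (\<theta> * \<rho> * S')"
proof -
  define U where "U = (h + 2) * S"
  define C where "C = h * U"
  have CE: "extendable C (\<rho> * C)"
    using extendable_mult[OF ext, of "h * (h + 2)"] by (simp add: C_def U_def algebra_simps)
  have U: "3 \<le> U" using S h mult_le_mono[of 3 "h + 2" 1 S] by (simp add: U_def)
  have C: "3 \<le> C" using U h mult_le_mono[of 1 h 3 U] by (simp add: C_def)
  have \<rho>h: "8 \<le> \<rho> * h" using \<rho> h by (simp add: field_simps)
  have \<rho>0: "0 \<le> \<rho>" using \<rho> by (rule order_trans[rotated]) simp
  define S' where "S' = h * C + S * (h + 2)"
  have S': "real S' = ((real h)\<^sup>2 + 1) * U"
    by (simp add: S'_def C_def U_def power2_eq_square algebra_simps)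
  have E': "\<theta> * \<rho> * S' = \<rho> * ((real h)\<^sup>2 + 1/2) * U"
  proof -
    have "(real h)\<^sup>2 + 1 \<noteq> 0" by (smt (verit) zero_le_power2)
    then show ?thesis unfolding S' \<theta>_def by simp
  qed
  have "8 * real S \<le> \<rho> * real U"
  proof -
    have "8 * real S \<le> (\<rho> * h) * real S" using \<rho>h by (intro mult_right_mono) auto
    also have "\<dots> \<le> \<rho> * real U" using \<rho>0 by (simp add: U_def algebra_simps)
    finally show ?thesis .
  qed
  then have A: "4 * real S + real h * (\<rho> * real C) \<le> \<theta> * \<rho> * S'"
    unfolding E' by (simp add: C_def power2_eq_square algebra_simps)
  have "8 * real U \<le> (\<rho> * h) * real U" using \<rho>h by (intro mult_right_mono) auto
  moreover have "0 \<le> \<rho> * real U" using \<rho>0 by simp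
  ultimately have 1: "real U + 3 \<le> \<rho> * h * real U + \<rho> * real U / 2" using U by linarith
  have "real (S * (h + 2)) = real U" by (simp add: U_def)
  then have B: "real (S * (h + 2)) + 3 + (real h - 1) * (\<rho> * real C) \<le> \<theta> * \<rho> * S'"
    using 1 unfolding E' by (simp only:) (simp add: C_def power2_eq_square algebra_simps)
  from extendable_combine[OF CE C A B] have "extendable S' (\<theta> * \<rho> * S')" by (simp only: S'_def)
  moreover have "1 \<le> S'" using S by (simp add: S'_def)
  ultimately show ?thesis by blast
qed

text \<open>\<open>\<theta>\<close> depends on \<open>h\<close> only. While the relative excess is
  at least \<open>8 / h\<close> it can be multiplied by \<open>\<theta>\<close>, and the powers of
  \<open>\<theta>\<close> eventually fall below that threshold.\<close>

lemma extendable_small: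
  assumes h: "1 \<le> h"
  shows "\<exists>S \<rho>. 1 \<le> S \<and> \<rho> \<le> 8 / real h \<and> extendable S (\<rho> * S)"
proof (rule ccontr)
  assume n: "\<not> ?thesis"
  define \<theta> where "\<theta> = ((real h)\<^sup>2 + 1/2) / ((real h)\<^sup>2 + 1)"
  have pos: "0 < (real h)\<^sup>2 + 1" by (smt (verit) zero_le_power2)
  have \<theta>: "0 \<le> \<theta>" "\<theta> < 1" using pos by (simp_all add: \<theta>_def)
  have "\<exists>S\<ge>1. extendable S (\<theta> ^ k * S)" for k
  proof (induction k)
    case 0
    show ?case using extendable_2 by (intro exI[of _ 2]) simp
  next
    case (Suc k)
    then obtain S where S: "1 \<le> S" "extendable S (\<theta> ^ k * S)" by blast
    then have "8 / real h \<le> \<theta> ^ k" using n by (meson linear)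
    from extendable_improve[OF S(2,1) h this] show ?case by (simp add: \<theta>_def)
  qed
  then have "8 / real h < \<theta> ^ k" for k using n by (meson not_le)
  moreover have "0 < 8 / real h" using h by simp
  then obtain k where "\<theta> ^ k < 8 / real h" using real_arch_pow_inv[OF _ \<theta>(2)] by blast
  ultimately show False by (meson less_asym)
qed

section \<open>Transversal ratios\<close>

lemma good_transversal:
  assumes g: "good F (9 + T)"
    and av: "\<And>I. avoids F I \<Longrightarrow> 2 * real (card (I \<inter> {9<..9 + T})) \<le> real T + E"
  defines "K \<equiv> faces F"
  shows "simplicial_sphere 4 K" "finite (vertices K)" "card (vertices K) \<le> T + 10"
    "real T - E \<le> 2 * real (transversal_number K)" "transversal_number K \<le> card (vertices K)"
proof -
  have F: "finite F" "\<And>\<sigma>. \<sigma> \<in> F \<Longrightarrow> finite \<sigma> \<and> card \<sigma> = 5" "geometric_realization K homeomorphic_space nsphere 4"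
    "\<Union>F \<subseteq> {..9 + T}"
    using g by (auto simp: good_def facet_sphere_def K_def)
  \<comment> \<open>The empty family has the empty realization, which is not a sphere. Excluding it
    puts \<open>{}\<close> into \<open>K\<close> as a face.\<close>
  have ne: "F \<noteq> {}"
  proof
    assume "F = {}"
    then have "geometric_realization K = trivial_topology"
      unfolding K_def by (subst geometric_realization_faces) (auto simp: bary_def)
    then show False using F(3) homeomorphic_empty_space_eq nonempty_nsphere by metis
  qed
  have "faces F = (\<Union>\<sigma>\<in>F. Pow \<sigma>)" by (auto simp: faces_def)
  then have finK: "finite K" using F by (simp add: K_def)
  have "simplicial_complex K"
    unfolding simplicial_complex_def
  proof (intro conjI ballI allI impI)
    show "{} \<in> K" using ne by (auto simp: K_def faces_def)
    show "finite \<sigma>" if "\<sigma> \<in> K" for \<sigma> using that F(2) finite_subset by (auto simp: K_def faces_def)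
    show "\<rho> \<in> K" if "\<sigma> \<in> K" "\<rho> \<subseteq> \<sigma>" for \<sigma> \<rho> using that by (auto simp: K_def faces_def)
  qed (rule finK)
  then show "simplicial_sphere 4 K" using F(3) by (simp add: simplicial_sphere_def)
  have V: "vertices K = \<Union>F" unfolding vertices_def K_def faces_def by blast
  show finV: "finite (vertices K)" unfolding V using F by auto
  have "card (vertices K) \<le> card {..9 + T}" unfolding V using F(4) by (intro card_mono) auto
  then show "card (vertices K) \<le> T + 10" by simp
  have facets: "facets K = F"
  proof (intro set_eqI iffI)
    fix \<sigma> assume "\<sigma> \<in> facets K"
    then have s: "\<sigma> \<in> K" "\<And>\<rho>. \<rho> \<in> K \<Longrightarrow> \<sigma> \<subseteq> \<rho> \<Longrightarrow> \<rho> = \<sigma>" by (auto simp: facets_def)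
    obtain \<tau> where t: "\<tau> \<in> F" "\<sigma> \<subseteq> \<tau>" using s(1) by (auto simp: K_def faces_def)
    then have "\<tau> \<in> K" by (auto simp: K_def faces_def)
    then show "\<sigma> \<in> F" using s(2)[of \<tau>] t by simp
  next
    fix \<sigma> assume s: "\<sigma> \<in> F"
    have "\<rho> = \<sigma>" if r: "\<rho> \<in> K" "\<sigma> \<subseteq> \<rho>" for \<rho>
    proof -
      obtain \<tau> where t: "\<tau> \<in> F" "\<rho> \<subseteq> \<tau>" using r by (auto simp: K_def faces_def)
      then have "\<sigma> = \<tau>" using F(2)[OF s] F(2)[OF t(1)] r card_subset_eq[of \<tau> \<sigma>] by auto
      then show ?thesis using t r by blast
    qed
    moreover have "\<sigma> \<in> K" using s by (auto simp: K_def faces_def)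
    ultimately show "\<sigma> \<in> facets K" by (auto simp: facets_def)
  qed
  let ?T = "{X. X \<subseteq> vertices K \<and> (\<forall>\<sigma>\<in>facets K. X \<inter> \<sigma> \<noteq> {})}"
  have finT: "finite (card ` ?T)" using finV by (intro finite_imageI finite_subset[of ?T "Pow (vertices K)"]) auto
  have VT: "vertices K \<in> ?T"
  proof -
    have "vertices K \<inter> \<sigma> \<noteq> {}" if "\<sigma> \<in> F" for \<sigma>
      using F(2)[OF that] that unfolding V by (metis Int_absorb1 Union_upper card.empty zero_neq_numeral)
    then show ?thesis unfolding facets by blast
  qed
  show "transversal_number K \<le> card (vertices K)"
    unfolding transversal_number_def using finT VT by (intro Min_le) auto
  have "transversal_number K \<in> card ` ?T"
    unfolding transversal_number_def using finT VT by (intro Min_in) auto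
  then obtain X where X: "X \<subseteq> vertices K" "\<forall>\<sigma>\<in>F. X \<inter> \<sigma> \<noteq> {}" "transversal_number K = card X"
    unfolding facets by blast
  have finX: "finite X" using X(1) finV finite_subset by blast
  \<comment> \<open>The complement is taken in all natural numbers, which is harmless because only
    its part on the path is counted.\<close>
  have "avoids F (- X)" using X(2) unfolding avoids_def by blast
  then have "2 * real (card (- X \<inter> {9<..9 + T})) \<le> real T + E" by (rule av)
  moreover have "card {9<..9 + T} = card (- X \<inter> {9<..9 + T}) + card (X \<inter> {9<..9 + T})"
  proof -
    have "{9<..9 + T} = (- X \<inter> {9<..9 + T}) \<union> (X \<inter> {9<..9 + T})" by blast
    then show ?thesis by (metis card_Un_disjoint finite_Int finite_greaterThanAtMost Compl_disjoint2
        Int_assoc Int_commute Int_empty_right Int_left_commute)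
  qed
  moreover have "card (X \<inter> {9<..9 + T}) \<le> card X" using finX by (intro card_mono) auto
  ultimately show "real T - E \<le> 2 * real (transversal_number K)" unfolding X(3) by simp
qed

lemma large_transversal_ratio:
  assumes \<delta>: "0 < \<delta>" "\<delta> \<le> 1/4"
  shows "\<exists>K :: nat set set. simplicial_sphere 4 K \<and> n \<le> card (vertices K) \<and> 1/2 - \<delta> \<le> transversal_ratio K"
proof -
  obtain h where h: "8 / \<delta> < real h" using reals_Archimedean2 by blast
  have h0: "0 < real h" using \<delta> h by (smt (verit) divide_pos_pos)
  then have "8 / real h \<le> \<delta>" using h \<delta> by (simp add: field_simps)
  moreover obtain S \<rho> where S: "1 \<le> S" "\<rho> \<le> 8 / real h" "extendable S (\<rho> * S)"
    using extendable_small[of h] h0 by auto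
  ultimately have \<rho>: "\<rho> \<le> \<delta>" by linarith
  \<comment> \<open>The term \<open>10 / \<delta>\<close> absorbs the ten vertices
    \<open>0, ..., 9\<close>, for which nothing is estimated; \<open>4 * n\<close> forces the
    complex to have more than \<open>n\<close> vertices.\<close>
  obtain k where k: "10 / \<delta> + 4 * real n < real k" using reals_Archimedean2 by blast
  define T where "T = k * S"
  have "k \<le> T" using S(1) mult_le_mono2[of 1 S k] by (simp add: T_def)
  then have "real k \<le> real T" by simp
  then have T: "10 / \<delta> + 4 * real n < real T" using k by linarith
  have ext: "extendable T (\<rho> * T)" using extendable_mult[OF S(3), of k] by (simp add: T_def algebra_simps)
  obtain F0 where "good F0 9" using good_base by blast
  then obtain F where F: "good F (9 + T)" "\<And>I. avoids F I \<Longrightarrow> 2 * real (card (I \<inter> {9<..9 + T})) \<le> real T + \<rho> * T"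
    using extendableE[OF ext] by blast
  define K where "K = faces F"
  note K = good_transversal[OF F, folded K_def]
  define v where "v = real (card (vertices K))"
  define t where "t = real (transversal_number K)"
  have v: "v \<le> real T + 10" using K(3) by (simp add: v_def)
  have tv: "t \<le> v" using K(5) by (simp add: v_def t_def)
  have "\<rho> * T \<le> \<delta> * T" using \<rho> by (simp add: mult_right_mono)
  then have t: "real T - \<delta> * T \<le> 2 * t" using K(4) by (simp add: t_def)
  \<comment> \<open>\<open>good\<close> bounds the vertex set only from above, so the number of
    vertices is bounded from below through the transversal number.\<close>
  have "\<delta> * T \<le> T / 4" using \<delta>(2) mult_right_mono[of \<delta> "1/4" "real T"] by simp
  moreover have "0 < 10 / \<delta>" using \<delta> by simp
  ultimately have "real n < t" using t T by linarith
  then have nv: "real n < v" using tv by linarith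
  have "10 \<le> \<delta> * T"
  proof -
    have "10 / \<delta> \<le> real T" using T by linarith
    then show ?thesis using \<delta>(1) by (simp add: field_simps)
  qed
  then have "(1/2 - \<delta>) * (real T + 10) \<le> t" using t \<delta> by (simp add: algebra_simps)
  moreover have "(1/2 - \<delta>) * v \<le> (1/2 - \<delta>) * (real T + 10)" using v \<delta> by (intro mult_left_mono) auto
  ultimately have "(1/2 - \<delta>) * v \<le> t" by linarith
  moreover have "0 < v" using nv by linarith
  ultimately have "1/2 - \<delta> \<le> t / v" by (simp add: field_simps)
  then show ?thesis
    using K(1) nv unfolding transversal_ratio_def v_def t_def by (intro exI[of _ K]) auto
qed

text \<open>The value \<open>Min {}\<close> accounts for complexes without a transversal.\<close>

lemma finite_transversal_ratios:
  "finite {transversal_ratio K | K :: nat set set. simplicial_sphere d K \<and> card (vertices K) = n}"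
proof -
  have "{transversal_ratio K | K :: nat set set. simplicial_sphere d K \<and> card (vertices K) = n} \<subseteq>
     (\<lambda>t. real t / real n) ` ({..n} \<union> {Min {}})"
  proof
    fix r assume "r \<in> {transversal_ratio K | K :: nat set set. simplicial_sphere d K \<and> card (vertices K) = n}"
    then obtain K :: "nat set set" where K: "simplicial_complex K" "card (vertices K) = n" "r = transversal_ratio K"
      by (auto simp: simplicial_sphere_def)
    let ?T = "{X. X \<subseteq> vertices K \<and> (\<forall>\<sigma>\<in>facets K. X \<inter> \<sigma> \<noteq> {})}"
    have fin: "finite (vertices K)" using K(1) by (auto simp: vertices_def simplicial_complex_def)
    have sub: "card ` ?T \<subseteq> {..n}" using card_mono[OF fin] K(2) by auto
    then have fin': "finite (card ` ?T)" by (rule finite_subset) simp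
    have "transversal_number K \<in> {..n} \<union> {Min {}}"
    proof (cases "card ` ?T = {}")
      case True
      show ?thesis unfolding transversal_number_def True by simp
    next
      case False
      show ?thesis using subsetD[OF sub Min_in[OF fin' False]] unfolding transversal_number_def by (rule UnI1)
    qed
    then show "r \<in> (\<lambda>t. real t / real n) ` ({..n} \<union> {Min {}})"
      unfolding K(3) transversal_ratio_def K(2) by (rule imageI)
  qed
  then show ?thesis by (rule finite_subset) simp
qed

theorem theorem5p7:
  shows "tau_S 5 \<ge> 1 / 2"
proof -
  define f where "f n = ereal (Max {transversal_ratio K | K :: nat set set.
     simplicial_sphere (5 - 1) K \<and> card (vertices K) = n})" for n
  have lim: "ereal (1/2 - \<delta>) \<le> limsup f" if \<delta>: "0 < \<delta>" "\<delta> \<le> 1/4" for \<delta>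
    unfolding limsup_INF_SUP
  proof (rule INF_greatest)
    fix n :: nat
    obtain K :: "nat set set" where K: "simplicial_sphere 4 K" "n \<le> card (vertices K)" "1/2 - \<delta> \<le> transversal_ratio K"
      using large_transversal_ratio[OF \<delta>] by blast
    have "transversal_ratio K \<le> Max {transversal_ratio K' | K' :: nat set set.
       simplicial_sphere (5 - 1) K' \<and> card (vertices K') = card (vertices K)}"
      using K(1) by (intro Max_ge finite_transversal_ratios) auto
    then have "ereal (1/2 - \<delta>) \<le> f (card (vertices K))" using K(3) by (simp add: f_def)
    then show "ereal (1/2 - \<delta>) \<le> (SUP m\<in>{n..}. f m)" using K(2) by (intro SUP_upper2) auto
  qed
  have "ereal (1/2) \<le> limsup f"
  proof (rule ereal_le_epsilon2)
    fix e :: real assume e: "0 < e"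
    define \<delta> where "\<delta> = min e (1/4)"
    have "ereal (1/2) \<le> ereal (1/2 - \<delta>) + ereal e" by (simp add: \<delta>_def)
    also have "\<dots> \<le> limsup f + ereal e" using lim[of \<delta>] e by (intro add_right_mono) (simp add: \<delta>_def)
    finally show "ereal (1/2) \<le> limsup f + ereal e" .
  qed
  moreover have "(1::ereal) / 2 = ereal (1/2)"
    by (metis ereal_divide numeral_eq_ereal one_ereal_def zero_neq_numeral)
  ultimately show ?thesis unfolding tau_S_def f_def by simp
qed

end
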